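(* Let $q$ be a real-valued, $1$-periodic function with $q\in L_1[0,1]$ and $\int_0^1 q(x)\,dx=0$. Let $\mu_{n,1}\le\mu_{n,2}$ be the large antiperiodic eigenvalues and let $\widetilde\alpha_{n,j}$ be as defined in the context. Then: (a) The eigenvalues $\mu_{n,1}$ and $\mu_{n,2}$ satisfy $$\mu_{n,j}-(2\pi n+\pi)^2=a_j|q_{2n+1}|+o(n^{-1})$$ for $j=1,2$ as $n\to\infty$, where $a_j$ (which may depend on $n$) is either $1$ or $-1$. (b) If, for all sufficiently large $n$, $$|q_{2n+1}|\ge2\left(|\widetilde\alpha_{n,1}|+|\widetilde\alpha_{n,2}|\right),$$ then there is $N$ such that the eigenvalues $\mu_{n,j}$ for $j=1,2$ and $n\ge N$ are simple, and they satisfy $$\mu_{n,j}=(2\pi n+\pi)^2+(-1)^j|q_{2n+1}|+o(n^{-1})$$ as $n\to\infty$.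
   Context: $L_\pi(q)$ is the operator in $L_2[0,1]$ generated by $-y''+qy$ with antiperiodic boundary conditions $y(1)=-y(0)$, $y'(1)=-y'(0)$. Its large eigenvalues, counted with multiplicity, form two sequences $\mu_{n,1}\le\mu_{n,2}$ ($n\ge N_0$, $N_0$ a sufficiently large integer) with $\mu_{n,j}=(2\pi n+\pi)^2+O(n^{1/2})$. $(\cdot,\cdot)$ is the inner product of $L_2[0,1]$ and, for integer $k$, $q_k=(q,e^{i2\pi kx})=\int_0^1q(x)e^{-i2\pi kx}dx$. $\Phi_{n,j}$ is a real-valued eigenfunction of $L_\pi(q)$ for $\mu_{n,j}$ with $L_2[0,1]$-norm $1$; if $\mu_{n,1}=\mu_{n,2}$, then $\Phi_{n,1}$ and $\Phi_{n,2}$ are chosen orthogonal. Put $v_{n,j}=(\Phi_{n,j},e^{i\pi(2n+1)x})$ and define $\widetilde\alpha_{n,j}$ by $$(\mu_{n,j}-(2\pi n+\pi)^2)v_{n,j}=q_{2n+1}\overline{v_{n,j}}+\widetilde\alpha_{n,j}.$$ (One has $\widetilde\alpha_{n,j}=o(n^{-1})$.)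
   Formalization: In (b), simplicity of the eigenvalues is asserted only for those n ≥ N with q_{2n+1} ≠ 0; as printed it fails for q = 0, where the inequality reads 0 ≥ 0 but every eigenvalue is double. *)

theory Defs
  imports "HOL-Analysis.Analysis" "HOL-Library.Landau_Symbols" "HOL-Library.Function_Algebras"
begin

definition L2_inner :: "(real \<Rightarrow> complex) \<Rightarrow> (real \<Rightarrow> complex) \<Rightarrow> complex" where
  "L2_inner f g = integral {0..1} (\<lambda>x. f x * cnj (g x))"

definition L2_norm :: "(real \<Rightarrow> complex) \<Rightarrow> real" where
  "L2_norm f = sqrt (integral {0..1} (\<lambda>x. (cmod (f x))\<^sup>2))"

definition in_L2 :: "(real \<Rightarrow> complex) \<Rightarrow> bool" where
  "in_L2 f \<longleftrightarrow> f \<in> borel_measurable (lebesgue_on {0..1})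
     \<and> (\<lambda>x. (cmod (f x))\<^sup>2) integrable_on {0..1}"

text \<open>
  \<open>f\<close> is absolutely continuous on [0,1] with a.e. derivative \<open>g\<close>, i.e. \<open>f\<close> is an
  indefinite Lebesgue integral of the L1 function \<open>g\<close>.
\<close>
definition abs_cont_deriv :: "(real \<Rightarrow> complex) \<Rightarrow> (real \<Rightarrow> complex) \<Rightarrow> bool" where
  "abs_cont_deriv f g \<longleftrightarrow> g absolutely_integrable_on {0..1}
     \<and> (\<forall>x\<in>{0..1}. f x = f 0 + integral {0..x} g)"

text \<open>
  Graph of the operator generated by \<open>- y'' + q y\<close> with \<open>y(1) = - y(0)\<close>, \<open>y'(1) = - y'(0)\<close>:
  the domain consists of the \<open>y\<close> with \<open>y\<close>, \<open>y'\<close> absolutely continuous and \<open>- y'' + q y\<close> in L2.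
  Since \<open>y1\<close> is itself absolutely continuous, hence continuous, it is the classical
  (at 0 and 1 one-sided) derivative of \<open>y\<close> at every point of [0,1]; \<open>y2\<close> is \<open>y''\<close>, determined a.e.
  Only the values on [0,1] matter.
\<close>
definition L_antiper :: "(real \<Rightarrow> real) \<Rightarrow> (real \<Rightarrow> complex) \<Rightarrow> (real \<Rightarrow> complex) \<Rightarrow> bool" where
  "L_antiper q y f \<longleftrightarrow>
     (\<exists>y1 y2. abs_cont_deriv y y1 \<and> abs_cont_deriv y1 y2
        \<and> y 1 = - y 0 \<and> y1 1 = - y1 0
        \<and> in_L2 f
        \<and> (AE x in lebesgue_on {0..1}. f x = - y2 x + complex_of_real (q x) * y x))"

definition eigenfunction :: "(real \<Rightarrow> real) \<Rightarrow> complex \<Rightarrow> (real \<Rightarrow> complex) \<Rightarrow> bool" where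
  "eigenfunction q l y \<longleftrightarrow> L_antiper q y (\<lambda>x. l * y x) \<and> (\<exists>x\<in>{0..1}. y x \<noteq> 0)"

text \<open>
  Functions on [0,1] are represented by their extension by zero, so that distinct members of the
  eigenspace are distinct elements of L2[0,1] (they are continuous on [0,1]).
\<close>
definition eigenspace :: "(real \<Rightarrow> real) \<Rightarrow> complex \<Rightarrow> (real \<Rightarrow> complex) set" where
  "eigenspace q l = {y. L_antiper q y (\<lambda>x. l * y x) \<and> (\<forall>x. x \<notin> {0..1} \<longrightarrow> y x = 0)}"

interpretation complex_fun: vector_space "\<lambda>(c::complex) (y :: real \<Rightarrow> complex) x. c * y x"
  by unfold_locales (auto simp: fun_eq_iff algebra_simps)

text \<open>For real \<open>q\<close> the operator is self-adjoint, so geometric and algebraic multiplicities agree.\<close>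
definition eigenvalue_multiplicity :: "(real \<Rightarrow> real) \<Rightarrow> complex \<Rightarrow> nat" where
  "eigenvalue_multiplicity q l = complex_fun.dim (eigenspace q l)"

definition simple_eigenvalue :: "(real \<Rightarrow> real) \<Rightarrow> complex \<Rightarrow> bool" where
  "simple_eigenvalue q l \<longleftrightarrow> eigenvalue_multiplicity q l = 1"


text \<open>
  The \<open>\<mu> n j\<close> with \<open>n \<ge> N0\<close>, \<open>j \<in> {1,2}\<close> list, with multiplicity, all eigenvalues above some bound.
\<close>
definition large_eigenvalues :: "(real \<Rightarrow> real) \<Rightarrow> nat \<Rightarrow> (nat \<Rightarrow> nat \<Rightarrow> real) \<Rightarrow> bool" where
  "large_eigenvalues q N0 \<mu> \<longleftrightarrow>
     (\<forall>n\<ge>N0. \<mu> n 1 \<le> \<mu> n 2)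
   \<and> (\<exists>R. (\<forall>n\<ge>N0. \<forall>j\<in>{1,2}. R \<le> \<mu> n j)
         \<and> (\<forall>t\<ge>R. card {(n, j). N0 \<le> n \<and> j \<in> {1,2} \<and> \<mu> n j = t} = eigenvalue_multiplicity q (complex_of_real t)))
   \<and> (\<forall>j\<in>{1,2}. (\<lambda>n. \<mu> n j - (2 * pi * real n + pi)\<^sup>2) \<in> O(\<lambda>n. sqrt (real n)))"

definition normalized_eigenfunctions ::
  "(real \<Rightarrow> real) \<Rightarrow> nat \<Rightarrow> (nat \<Rightarrow> nat \<Rightarrow> real) \<Rightarrow> (nat \<Rightarrow> nat \<Rightarrow> real \<Rightarrow> real) \<Rightarrow> bool" where
  "normalized_eigenfunctions q N0 \<mu> \<Phi> \<longleftrightarrow>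
     (\<forall>n\<ge>N0.
        (\<forall>j\<in>{1,2}. eigenfunction q (complex_of_real (\<mu> n j)) (\<lambda>x. complex_of_real (\<Phi> n j x))
                   \<and> L2_norm (\<lambda>x. complex_of_real (\<Phi> n j x)) = 1)
      \<and> (\<mu> n 1 = \<mu> n 2 \<longrightarrow>
           L2_inner (\<lambda>x. complex_of_real (\<Phi> n 1 x)) (\<lambda>x. complex_of_real (\<Phi> n 2 x)) = 0))"

definition fourier_coeff :: "(real \<Rightarrow> real) \<Rightarrow> int \<Rightarrow> complex" where
  "fourier_coeff q k =
     L2_inner (\<lambda>x. complex_of_real (q x)) (\<lambda>x. exp (\<i> * complex_of_real (2 * pi * of_int k * x)))"

definition v_coeff :: "(nat \<Rightarrow> nat \<Rightarrow> real \<Rightarrow> real) \<Rightarrow> nat \<Rightarrow> nat \<Rightarrow> complex" where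
  "v_coeff \<Phi> n j =
     L2_inner (\<lambda>x. complex_of_real (\<Phi> n j x))
              (\<lambda>x. exp (\<i> * complex_of_real (pi * (2 * real n + 1) * x)))"

text \<open>
  The remainder in
  \<open>(\<mu> n j - (2 \<pi> n + \<pi>)\<^sup>2) v = q_(2n+1) cnj v + alpha_tilde\<close>, solved for the last term.
\<close>
definition alpha_tilde ::
  "(real \<Rightarrow> real) \<Rightarrow> (nat \<Rightarrow> nat \<Rightarrow> real) \<Rightarrow> (nat \<Rightarrow> nat \<Rightarrow> real \<Rightarrow> real) \<Rightarrow> nat \<Rightarrow> nat \<Rightarrow> complex" where
  "alpha_tilde q \<mu> \<Phi> n j =
     complex_of_real (\<mu> n j - (2 * pi * real n + pi)\<^sup>2) * v_coeff \<Phi> n j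
       - fourier_coeff q (2 * int n + 1) * cnj (v_coeff \<Phi> n j)"

end

theory Submission
  imports Defs "HOL-Real_Asymp.Real_Asymp"
begin

text \<open>
  Fix \<open>n\<close>, put \<open>w = (2 n + 1) \<pi>\<close> and \<open>d = \<mu> - w\<^sup>2\<close>. A real eigenfunction \<open>\<Phi>\<close> solves
  \<open>\<Phi>'' + w\<^sup>2 \<Phi> = (q - d) \<Phi>\<close>. Variation of constants writes it as
  \<open>\<Phi> x = a x e\<^bsup>i w x\<^esup> + cnj (a x) e\<^bsup>- i w x\<^esup>\<close> with
  \<open>a' = (q - d) \<Phi> e\<^bsup>- i w x\<^esup> / (2 i w)\<close>, and antiperiodicity of \<open>\<Phi>\<close> becomes \<open>a 1 = a 0\<close>
  (\<open>eigenfunction_amplitude\<close>). The amplitude is therefore constant up to a relative error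
  \<open>O((\<parallel>q\<parallel> + \<bar>d\<bar>) / w)\<close>, where \<open>\<parallel>q\<parallel>\<close> is the L1 norm. With the normalization of \<open>\<Phi>\<close> this
  gives \<open>\<bar>v\<bar>\<^sup>2 \<longrightarrow> 1/2\<close>.

  Integrating \<open>a'\<close> over the period yields \<open>d v = \<integral> q \<Phi> e\<^bsup>- i w x\<^esup> = \<integral> q a + \<integral> q cnj a e\<^bsup>- 2 i w x\<^esup>\<close>.
  Replacing \<open>a\<close> by the constant \<open>a 0\<close> leaves \<open>cnj (a 0) q\<^sub>2\<^sub>n\<^sub>+\<^sub>1\<close>, because \<open>q\<close> has mean zero; so
  \<open>d \<longrightarrow> 0\<close>. The error of this replacement is \<open>o(1/n)\<close>, not merely \<open>O(1/n)\<close>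
  (\<open>remainder_le\<close>). Integration by parts turns the two error integrals into \<open>1 / (2 w)\<close> times
  integrals in which \<open>(q - d) \<Phi>\<close> is multiplied by a primitive of \<open>q\<close> or of \<open>q e\<^bsup>- 2 i w x\<^esup>\<close>. For the
  primitive \<open>Q\<close> of \<open>q\<close> the leading part is \<open>\<integral> Q q = (Q 1\<^sup>2 - Q 0\<^sup>2) / 2 = 0\<close>, and everything else
  tends to zero by the Riemann-Lebesgue lemma and dominated convergence, or because \<open>d\<close> does.
  Passing from \<open>a 0\<close> to \<open>v\<close> in the main term costs \<open>O(1/n)\<close> times \<open>q\<^sub>2\<^sub>n\<^sub>+\<^sub>1 = o(1)\<close>. Hence
  \<open>d v = q\<^sub>2\<^sub>n\<^sub>+\<^sub>1 cnj v + o(1/n)\<close>, and taking absolute values proves (a).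

  For (b), eigenfunctions of one pair are orthogonal, so \<open>v\<^sub>1\<close> and \<open>v\<^sub>2\<close> are, up to \<open>o(1)\<close>,
  orthogonal vectors of the real plane of length \<open>1 / sqrt 2\<close>. The real-linear map
  \<open>v \<mapsto> d v - c cnj v\<close> with \<open>c = q\<^sub>2\<^sub>n\<^sub>+\<^sub>1\<close> has the two stretching factors \<open>\<bar>d - \<bar>c\<bar>\<bar>\<close> and
  \<open>\<bar>d + \<bar>c\<bar>\<bar>\<close> along two fixed orthogonal axes. If \<open>d\<^sub>1\<close> and \<open>d\<^sub>2\<close> had the same weak sign, the
  same axis would be stretched by at least \<open>\<bar>c\<bar>\<close> for both, and the remainders would add up to more
  than \<open>\<bar>c\<bar> / 2\<close>, against the hypothesis (\<open>same_sign_remainder_large\<close>). So \<open>d\<^sub>1 < 0 < d\<^sub>2\<close>, which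
  selects the signs in (a) and makes the two eigenvalues distinct. Levels belonging to different
  \<open>n\<close> are far apart, so the enumeration counts each such eigenvalue exactly once.
\<close>

section \<open>Absolutely continuous functions\<close>

lemma absolutely_integrable_continuous_mult:
  fixes F g :: "real \<Rightarrow> complex"
  assumes F: "continuous_on {a..b} F" and g: "g absolutely_integrable_on {a..b}"
  shows "(\<lambda>x. F x * g x) absolutely_integrable_on {a..b}"
proof (rule absolutely_integrable_bounded_measurable_product[OF bilinear_times _ _ _ g])
  show "F \<in> borel_measurable (lebesgue_on {a..b})"
    by (rule continuous_imp_measurable_on_sets_lebesgue[OF F]) auto
  show "bounded (F ` {a..b})"
    by (rule compact_imp_bounded[OF compact_continuous_image[OF F compact_Icc]])
qed auto

lemma norm_integral_mult_le:
  fixes F g :: "real \<Rightarrow> complex"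
  assumes F: "continuous_on {a..b} F" and g: "g absolutely_integrable_on {a..b}"
    and B: "\<And>x. x \<in> {a..b} \<Longrightarrow> cmod (F x) \<le> B"
  shows "cmod (integral {a..b} (\<lambda>x. F x * g x)) \<le> B * integral {a..b} (\<lambda>x. cmod (g x))"
proof -
  have "(\<lambda>x. F x * g x) integrable_on {a..b}"
    using absolutely_integrable_continuous_mult[OF F g] set_lebesgue_integral_eq_integral(1) by blast
  moreover have "(\<lambda>x. B * cmod (g x)) integrable_on {a..b}"
    using g by (intro integrable_on_mult_right) (auto simp: absolutely_integrable_on_def)
  ultimately have "cmod (integral {a..b} (\<lambda>x. F x * g x)) \<le> integral {a..b} (\<lambda>x. B * cmod (g x))"
    by (rule integral_norm_bound_integral) (simp add: B norm_mult mult_right_mono)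
  then show ?thesis by simp
qed

lemma abs_cont_deriv_integrable:
  assumes "abs_cont_deriv F f" "0 \<le> a" "b \<le> 1"
  shows "f absolutely_integrable_on {a..b}" "f integrable_on {a..b}"
proof -
  show *: "f absolutely_integrable_on {a..b}"
    using assms by (auto simp: abs_cont_deriv_def intro: absolutely_integrable_on_subinterval)
  then show "f integrable_on {a..b}"
    using set_lebesgue_integral_eq_integral(1) by blast
qed

lemma abs_cont_derivD:
  "abs_cont_deriv F f \<Longrightarrow> x \<in> {0..1} \<Longrightarrow> F x = F 0 + integral {0..x} f"
  unfolding abs_cont_deriv_def by blast

lemma abs_cont_deriv_diff_eq:
  assumes F: "abs_cont_deriv F f" and "0 \<le> a" "a \<le> b" "b \<le> 1"
  shows "F b - F a = integral {a..b} f"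
proof -
  have "integral {0..a} f + integral {a..b} f = integral {0..b} f"
    by (rule Henstock_Kurzweil_Integration.integral_combine[OF assms(2,3)
          abs_cont_deriv_integrable(2)[OF F order_refl assms(4)]])
  moreover have "F b = F 0 + integral {0..b} f" "F a = F 0 + integral {0..a} f"
    by (rule abs_cont_derivD[OF F]; use assms(2-4) in simp)+
  ultimately show ?thesis by (metis add_diff_cancel_left add_diff_cancel_left')
qed

lemma abs_cont_deriv_continuous:
  assumes F: "abs_cont_deriv F f"
  shows "continuous_on {0..1} F"
proof -
  have "continuous_on {0..1} (\<lambda>x. F 0 + integral {0..x} f)"
    using abs_cont_deriv_integrable(2)[OF F order_refl order_refl]
    by (intro continuous_on_add continuous_on_const indefinite_integral_continuous_1)
  then show ?thesis
    by (rule continuous_on_eq) (rule abs_cont_derivD[OF F, symmetric])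
qed

text \<open>
  Going from \<open>0\<close> to \<open>x\<close> in steps of length \<open>d / 2\<close> adds up the local estimates, since the integral
  of \<open>H\<close> is additive over intervals. The factor \<open>e\<close> is not multiplied by the number of steps,
  which is what allows it to be sent to zero afterwards.
\<close>
lemma small_increments_imp_bounded:
  fixes E :: "real \<Rightarrow> complex" and H :: "real \<Rightarrow> real"
  assumes H: "H integrable_on {0..1}" and d: "d > 0"
    and inc: "\<And>a b. \<lbrakk>0 \<le> a; a \<le> b; b \<le> 1; b - a < d\<rbrakk> \<Longrightarrow> cmod (E b - E a) \<le> e * integral {a..b} H"
    and x: "0 \<le> x" "x \<le> 1"
  shows "cmod (E x - E 0) \<le> e * integral {0..x} H"
proof -
  have "\<forall>x. 0 \<le> x \<and> x \<le> 1 \<and> x \<le> real n * (d/2) \<longrightarrow> cmod (E x - E 0) \<le> e * integral {0..x} H" for n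
  proof (induction n)
    case 0
    show ?case
    proof (intro allI impI)
      fix x :: real assume "0 \<le> x \<and> x \<le> 1 \<and> x \<le> real 0 * (d/2)"
      then have "x = 0" by simp
      then show "cmod (E x - E 0) \<le> e * integral {0..x} H" by simp
    qed
  next
    case (Suc n)
    show ?case
    proof (intro allI impI)
      fix x assume x: "0 \<le> x \<and> x \<le> 1 \<and> x \<le> real (Suc n) * (d/2)"
      define a where "a = max 0 (x - d/2)"
      have a: "0 \<le> a" "a \<le> x" "x - a < d" "a \<le> real n * (d/2)"
        using x d by (auto simp: a_def algebra_simps max_def)
      have "cmod (E x - E 0) \<le> cmod (E a - E 0) + cmod (E x - E a)"
        by (metis add.commute diff_add_cancel add_diff_eq norm_triangle_ineq)
      also have "\<dots> \<le> e * integral {0..a} H + e * integral {a..x} H"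
        using Suc a x inc[of a x] by (intro add_mono) auto
      also have "\<dots> = e * integral {0..x} H"
      proof -
        have "H integrable_on {0..x}" 
          by (rule integrable_on_subinterval[OF H]) (use x in auto)
        then have "integral {0..a} H + integral {a..x} H = integral {0..x} H"
          using a by (intro Henstock_Kurzweil_Integration.integral_combine) auto
        then show ?thesis by (metis distrib_left)
      qed
      finally show "cmod (E x - E 0) \<le> e * integral {0..x} H" .
    qed
  qed
  moreover obtain n where "real n * (d/2) \<ge> 1" 
    using reals_Archimedean3[of "d/2"] d by (meson half_gt_zero less_imp_le)
  ultimately show ?thesis using x by (meson order_trans)
qed

text \<open>
  The factors are differentiable only almost everywhere, and the product rule is needed in integrated
  form. It holds because the function \<open>E\<close> of the proof, the defect of the product rule, has increments
  that are small compared with those of a fixed monotone function and is therefore constant.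
\<close>
lemma abs_cont_deriv_mult:
  assumes F: "abs_cont_deriv F f" and G: "abs_cont_deriv G g"
  shows "abs_cont_deriv (\<lambda>x. F x * G x) (\<lambda>x. F x * g x + G x * f x)"
proof -
  note cF = abs_cont_deriv_continuous[OF F] and cG = abs_cont_deriv_continuous[OF G]
  define h where "h = (\<lambda>x. F x * g x + G x * f x)"
  define H where "H = (\<lambda>x. cmod (g x) + cmod (f x))"
  define E where "E = (\<lambda>x. F x * G x - integral {0..x} h)"
  have f: "f absolutely_integrable_on {0..1}" and g: "g absolutely_integrable_on {0..1}"
    using F G by (auto simp: abs_cont_deriv_def)
  have h: "h absolutely_integrable_on {0..1}"
    unfolding h_def by (intro set_integral_add absolutely_integrable_continuous_mult f g cF cG)
  have hi: "h integrable_on {a..b}" if "0 \<le> a" "b \<le> 1" for a b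
    using absolutely_integrable_on_subinterval[OF h, of a b] that set_lebesgue_integral_eq_integral(1) by auto
  have H: "H integrable_on {0..1}"
    unfolding H_def by (intro integrable_add) (use f g in \<open>auto simp: absolutely_integrable_on_def\<close>)
  \<comment> \<open>On a short interval the defect of the product rule is an integral of the oscillations of
    \<open>F\<close> and \<open>G\<close> against \<open>g\<close> and \<open>f\<close>, which uniform continuity makes a small multiple of the
    integral of \<open>H\<close>.\<close>
  have small: "cmod (E x - E 0) \<le> e * integral {0..x} H" if e: "e > 0" and x: "0 \<le> x" "x \<le> 1" for e x
  proof -
    obtain d1 where d1: "d1 > 0" "\<And>x y. \<lbrakk>x \<in> {0..1}; y \<in> {0..1}; dist y x < d1\<rbrakk> \<Longrightarrow> dist (F y) (F x) < e"
      using compact_uniformly_continuous[OF cF compact_Icc] e unfolding uniformly_continuous_on_def by metis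
    obtain d2 where d2: "d2 > 0" "\<And>x y. \<lbrakk>x \<in> {0..1}; y \<in> {0..1}; dist y x < d2\<rbrakk> \<Longrightarrow> dist (G y) (G x) < e"
      using compact_uniformly_continuous[OF cG compact_Icc] e unfolding uniformly_continuous_on_def by metis
    show ?thesis
    proof (rule small_increments_imp_bounded[OF H _ _ x])
      show "min d1 d2 > 0" using d1 d2 by simp
      fix a b :: real assume ab: "0 \<le> a" "a \<le> b" "b \<le> 1" "b - a < min d1 d2"
      have fi: "f absolutely_integrable_on {a..b}" and gi: "g absolutely_integrable_on {a..b}"
        by (auto intro: abs_cont_deriv_integrable[OF F] abs_cont_deriv_integrable[OF G] ab)
      have sub: "{a..b} \<subseteq> {0..1}" using ab by auto
      have cF': "continuous_on {a..b} F" and cG': "continuous_on {a..b} G"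
        using cF cG sub continuous_on_subset by blast+
      have i: "(\<lambda>x. F b * g x) integrable_on {a..b}" "(\<lambda>x. G a * f x) integrable_on {a..b}"
        using fi gi set_lebesgue_integral_eq_integral(1) by (auto intro!: integrable_on_mult_right)
      have "integral {0..a} h + integral {a..b} h = integral {0..b} h"
        by (intro Henstock_Kurzweil_Integration.integral_combine hi) (use ab in auto)
      then have "E b - E a = F b * (G b - G a) + (F b - F a) * G a - integral {a..b} h"
        by (simp add: E_def algebra_simps)
      also have "\<dots> = integral {a..b} (\<lambda>x. F b * g x) + integral {a..b} (\<lambda>x. G a * f x) - integral {a..b} h"
        using abs_cont_deriv_diff_eq[OF F, of a b] abs_cont_deriv_diff_eq[OF G, of a b] ab by simp
      also have "\<dots> = integral {a..b} (\<lambda>x. F b * g x + G a * f x - h x)"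
        using i hi[of a b] ab by (simp add: integral_add integral_diff integrable_add)
      also have "cmod \<dots> \<le> integral {a..b} (\<lambda>x. e * H x)"
      proof (rule integral_norm_bound_integral)
        show "(\<lambda>x. F b * g x + G a * f x - h x) integrable_on {a..b}"
          using i hi[of a b] ab by (auto intro!: integrable_add integrable_diff)
        show "(\<lambda>x. e * H x) integrable_on {a..b}"
          using integrable_on_subinterval[OF H sub] by (auto intro!: integrable_on_mult_right)
        fix x assume x: "x \<in> {a..b}"
        have "F b * g x + G a * f x - h x = (F b - F x) * g x + (G a - G x) * f x"
          by (simp add: h_def algebra_simps)
        moreover have "cmod (F b - F x) \<le> e"
          using d1(2)[of x b] x ab by (auto simp: dist_norm less_imp_le)
        moreover have "cmod (G a - G x) \<le> e"
          using d2(2)[of x a] x ab by (auto simp: dist_norm less_imp_le)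
        ultimately have "cmod (F b * g x + G a * f x - h x) \<le> e * cmod (g x) + e * cmod (f x)"
          by (metis add_mono norm_mult mult_right_mono norm_ge_zero norm_triangle_le)
        then show "cmod (F b * g x + G a * f x - h x) \<le> e * H x"
          by (simp add: H_def algebra_simps)
      qed
      finally show "cmod (E b - E a) \<le> e * integral {a..b} H" by simp
    qed
  qed
  have "E x = E 0" if x: "0 \<le> x" "x \<le> 1" for x
  proof -
    define I where "I = integral {0..x} H"
    have "I \<ge> 0" unfolding I_def
      by (rule integral_nonneg) (use x in \<open>auto simp: H_def intro: integrable_on_subinterval[OF H, unfolded H_def]\<close>)
    have "cmod (E x - E 0) \<le> 0 + e" if "e > 0" for e
    proof -
      have "cmod (E x - E 0) \<le> e / (I + 1) * I"
        using small[of "e / (I+1)" x] \<open>I \<ge> 0\<close> that x by (simp add: I_def)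
      also have "\<dots> \<le> e" using that \<open>I \<ge> 0\<close> by (simp add: field_simps)
      finally show ?thesis by simp
    qed
    then have "cmod (E x - E 0) \<le> 0" by (rule field_le_epsilon)
    then show ?thesis by simp
  qed
  moreover have "E 0 = F 0 * G 0" by (simp add: E_def)
  ultimately have "F x * G x - integral {0..x} h = F 0 * G 0" if "x \<in> {0..1}" for x
    using that unfolding E_def by (metis atLeastAtMost_iff)
  then have "\<forall>x\<in>{0..1}. F x * G x = F 0 * G 0 + integral {0..x} h"
    by (metis diff_add_cancel)
  then show ?thesis using h unfolding abs_cont_deriv_def h_def by blast
qed

section \<open>Fourier coefficients of integrable functions\<close>

lemma has_vector_derivative_cis_linear:
  "((\<lambda>x. cis (c * x)) has_vector_derivative (\<i> * of_real c * cis (c * x))) (at x within S)"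
proof -
  have "((\<lambda>z. exp (\<i> * of_real c * z)) has_field_derivative (\<i> * of_real c * exp (\<i> * of_real c * of_real x)))
      (at (of_real x))"
    by (auto intro!: derivative_eq_intros)
  from has_vector_derivative_real_field[OF this, of S] show ?thesis
    by (simp add: cis_conv_exp mult.assoc)
qed

lemma integral_cis_period:
  fixes k :: int
  shows "integral {0..1} (\<lambda>x. cis (2 * pi * of_int k * x)) = (if k = 0 then 1 else 0)"
proof (cases "k = 0")
  case False
  define c where "c = 2 * pi * of_int k"
  have c: "c \<noteq> 0" using False by (simp add: c_def)
  have "((\<lambda>x. cis (c * x) / (\<i> * of_real c)) has_vector_derivative cis (c * x)) (at x within {0..1})" for x
    using has_vector_derivative_divide[OF has_vector_derivative_cis_linear[of c x "{0..1}"], of "\<i> * of_real c"] c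
    by simp
  then have "((\<lambda>x. cis (c * x)) has_integral (cis (c * 1) / (\<i> * of_real c) - cis (c * 0) / (\<i> * of_real c))) {0..1}"
    by (intro fundamental_theorem_of_calculus) auto
  moreover have "cis (c * 1) = 1" unfolding c_def by (subst mult_1_right) (rule cis_multiple_2pi, simp)
  ultimately have "((\<lambda>x. cis (c * x)) has_integral 0) {0..1}" by simp
  then show ?thesis using False by (simp add: c_def integral_unique)
qed simp

text \<open>
  The Lebesgue integral is used here, rather than the gauge integral as elsewhere, because
  the approximation of integrable functions proceeds by induction over a measure.
\<close>
definition trig_coeff :: "(real \<Rightarrow> complex) \<Rightarrow> nat \<Rightarrow> complex" where
  "trig_coeff f k = (LINT x|lebesgue_on {0..1}. f x * cis (- (2 * pi * real k * x)))"

lemma cis_measurable [measurable]: "(\<lambda>x. cis (c * x)) \<in> borel_measurable (lebesgue_on {0..1})"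
  by (intro continuous_imp_measurable_on_sets_lebesgue continuous_intros) auto

text \<open>
  Bessel's inequality: the function \<open>P N\<close> of the proof is what remains of \<open>f\<close> after its first \<open>N\<close>
  Fourier terms are removed, and each further removal lowers the squared norm by exactly the squared
  modulus of the next coefficient.
\<close>
lemma bessel_bounded:
  fixes f :: "real \<Rightarrow> complex"
  assumes [measurable]: "f \<in> borel_measurable (lebesgue_on {0..1})" and B: "\<And>x. x \<in> {0..1} \<Longrightarrow> cmod (f x) \<le> B"
  shows "(\<Sum>k<N. (cmod (trig_coeff f k))\<^sup>2) \<le> (LINT x|lebesgue_on {0..1}. (cmod (f x))\<^sup>2)"
proof -
  define M where "M = lebesgue_on {0..1::real}"
  define E where "E = (\<lambda>(k::nat) x. cis (2 * pi * real k * x))"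
  define c where "c = trig_coeff f"
  define P where "P = (\<lambda>N x. f x - (\<Sum>k<N. c k * E k x))"
  interpret finite_measure M
    unfolding M_def by (rule finite_measure_lebesgue_on) simp
  have sM: "space M = {0..1}" by (simp add: M_def)
  have mM: "measure M (space M) = 1" by (simp add: M_def measure_restrict_space)
  have [measurable]: "f \<in> borel_measurable M" "E k \<in> borel_measurable M" for k
    using assms by (auto simp: M_def E_def)
  have [measurable]: "(\<lambda>x. cnj (E k x)) \<in> borel_measurable M" for k
    using cis_measurable[of "- (2 * pi * real k)"] by (simp add: E_def cis_cnj M_def)
  have [measurable]: "P N \<in> borel_measurable M" for N unfolding P_def by measurable
  have nE: "cmod (E k x) = 1" for k x by (simp add: E_def)
  have bP: "cmod (P N x) \<le> B + (\<Sum>k<N. cmod (c k))" if "x \<in> space M" for N x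
  proof -
    have "cmod (\<Sum>k<N. c k * E k x) \<le> (\<Sum>k<N. cmod (c k))"
      by (rule order_trans[OF norm_sum]) (simp add: norm_mult nE)
    moreover have "cmod (f x) \<le> B" using B[of x] that sM by simp
    ultimately show ?thesis unfolding P_def
      by (meson add_mono norm_triangle_ineq4 order_trans)
  qed
  have iP: "integrable M (\<lambda>x. P N x * cnj (E k x))" for N k
    by (rule integrable_const_bound[of _ "B + (\<Sum>k<N. cmod (c k))"])
       (use bP in \<open>auto simp: norm_mult nE\<close>)
  have iP2: "integrable M (\<lambda>x. (cmod (P N x))\<^sup>2)" for N
    by (rule integrable_const_bound[of _ "(B + (\<Sum>k<N. cmod (c k)))\<^sup>2"])
       (use bP in \<open>auto intro!: power_mono\<close>)
  have iE: "integrable M (\<lambda>x. E k x * cnj (E m x))" for k m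
    by (rule integrable_const_bound[of _ 1]) (auto simp: norm_mult nE)
  have ortho: "(LINT x|M. E k x * cnj (E m x)) = (if k = m then 1 else 0)" for k m
  proof -
    have "(LINT x|M. E k x * cnj (E m x)) = integral {0..1} (\<lambda>x. E k x * cnj (E m x))"
      using iE[of k m] unfolding M_def by (rule lebesgue_integral_eq_integral) simp
    also have "\<dots> = integral {0..1} (\<lambda>x. cis (2 * pi * of_int (int k - int m) * x))"
      by (simp add: E_def cis_mult cis_cnj algebra_simps)
    finally show ?thesis unfolding integral_cis_period by simp
  qed
  have PE: "(LINT x|M. P N x * cnj (E N x)) = c N" for N
  proof -
    have "integrable M (\<lambda>x. f x * cnj (E N x))" using iP[of 0 N] by (simp add: P_def)
    then have "(LINT x|M. P N x * cnj (E N x))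
        = (LINT x|M. f x * cnj (E N x)) - (\<Sum>k<N. c k * (LINT x|M. E k x * cnj (E N x)))"
      unfolding P_def by (simp add: left_diff_distrib sum_distrib_right mult.assoc iE)
    also have "(\<Sum>k<N. c k * (LINT x|M. E k x * cnj (E N x))) = 0"
      by (simp add: ortho)
    also have "(LINT x|M. f x * cnj (E N x)) = c N"
      by (simp add: c_def trig_coeff_def M_def E_def cis_cnj)
    finally show ?thesis by simp
  qed
  have "(LINT x|M. (cmod (P N x))\<^sup>2) = (LINT x|M. (cmod (f x))\<^sup>2) - (\<Sum>k<N. (cmod (c k))\<^sup>2)" for N
  proof (induction N)
    case 0 show ?case by (simp add: P_def)
  next
    case (Suc N)
    have *: "(cmod (z - w * e))\<^sup>2 = (cmod z)\<^sup>2 - 2 * Re (cnj w * (z * cnj e)) + (cmod w)\<^sup>2"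
      if "cmod e = 1" for z w e
    proof -
      have "(cmod (z - w * e))\<^sup>2 = (cmod z)\<^sup>2 - 2 * Re (cnj w * (z * cnj e)) + (cmod (w * e))\<^sup>2"
        unfolding cmod_power2 by (simp add: power2_eq_square algebra_simps)
      then show ?thesis using that by (simp add: norm_mult)
    qed
    have "P (Suc N) x = P N x - c N * E N x" for x by (simp add: P_def)
    then have "(LINT x|M. (cmod (P (Suc N) x))\<^sup>2)
        = (LINT x|M. (cmod (P N x))\<^sup>2 - 2 * Re (cnj (c N) * (P N x * cnj (E N x))) + (cmod (c N))\<^sup>2)"
      by (simp add: *[OF nE])
    also have "\<dots> = (LINT x|M. (cmod (P N x))\<^sup>2) - 2 * Re (cnj (c N) * (LINT x|M. P N x * cnj (E N x))) + (cmod (c N))\<^sup>2"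
    proof -
      define u where "u = (\<lambda>x. cnj (c N) * (P N x * cnj (E N x)))"
      have u: "integrable M u" using iP[of N N] by (simp add: u_def)
      have "(LINT x|M. (cmod (P N x))\<^sup>2 - 2 * Re (u x) + (cmod (c N))\<^sup>2)
          = (LINT x|M. (cmod (P N x))\<^sup>2) - 2 * Re (LINT x|M. u x) + (cmod (c N))\<^sup>2"
        using iP2[of N] integrable_Re[OF u] integral_Re[OF u] mM by simp
      moreover have "(LINT x|M. u x) = cnj (c N) * (LINT x|M. P N x * cnj (E N x))"
        by (simp add: u_def)
      ultimately show ?thesis by (simp add: u_def)
    qed
    also have "cnj (c N) * (LINT x|M. P N x * cnj (E N x)) = of_real ((cmod (c N))\<^sup>2)"
      by (simp add: PE complex_norm_square mult.commute del: of_real_power)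
    finally show ?case using Suc by simp
  qed
  moreover have "(LINT x|M. (cmod (P N x))\<^sup>2) \<ge> 0" for N by simp
  ultimately show ?thesis by (simp add: c_def M_def)
qed

lemma trig_coeff_bounded_tendsto_0:
  fixes f :: "real \<Rightarrow> complex"
  assumes "f \<in> borel_measurable (lebesgue_on {0..1})" and "\<And>x. x \<in> {0..1} \<Longrightarrow> cmod (f x) \<le> B"
  shows "trig_coeff f \<longlonglongrightarrow> 0"
proof -
  have "summable (\<lambda>k. (cmod (trig_coeff f k))\<^sup>2)"
    by (rule summableI_nonneg_bounded[OF _ bessel_bounded[OF assms]]) auto
  then have "(\<lambda>k. (cmod (trig_coeff f k))\<^sup>2) \<longlonglongrightarrow> 0" by (rule summable_LIMSEQ_zero)
  then have "(\<lambda>k. sqrt ((cmod (trig_coeff f k))\<^sup>2)) \<longlonglongrightarrow> sqrt 0" by (rule tendsto_real_sqrt)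
  then show ?thesis by (simp add: tendsto_norm_zero_iff)
qed

text \<open>
  Each coefficient is 1-Lipschitz in the L1 norm, so decay passes from bounded functions, where
  Bessel's inequality provides it, to their L1 limits.
\<close>
lemma trig_coeff_tendsto_0:
  fixes f :: "real \<Rightarrow> complex"
  assumes "integrable (lebesgue_on {0..1}) f"
  shows "trig_coeff f \<longlonglongrightarrow> 0"
proof -
  define M where "M = lebesgue_on {0..1::real}"
  have cM [measurable]: "(\<lambda>x. cis (- (2 * pi * real k * x))) \<in> borel_measurable M" for k
    using cis_measurable[of "- (2 * pi * real k)"] by (simp add: M_def)
  have int: "integrable M (\<lambda>x. f x * cis (- (2 * pi * real k * x)))" if "integrable M f" for f k
  proof (rule Bochner_Integration.integrable_bound[OF integrable_norm[OF that]])
    have [measurable]: "f \<in> borel_measurable M" using that by simp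
    show "(\<lambda>x. f x * cis (- (2 * pi * real k * x))) \<in> borel_measurable M" by measurable
  qed (simp add: norm_mult)
  have diff: "trig_coeff f k - trig_coeff g k = (LINT x|M. (f x - g x) * cis (- (2 * pi * real k * x)))"
    if "integrable M f" "integrable M g" for f g k
    using int[OF that(1)] int[OF that(2)] by (simp add: trig_coeff_def M_def left_diff_distrib)
  show ?thesis
    using assms unfolding M_def[symmetric]
  proof (induction rule: integrable_induct)
    case (base A c)
    show ?case
      by (rule trig_coeff_bounded_tendsto_0[of _ "cmod c"])
         (use base in \<open>auto simp: M_def indicator_def intro!: borel_measurable_scaleR borel_measurable_indicator\<close>)
  next
    case (add f g)
    have "trig_coeff (\<lambda>x. f x + g x) = (\<lambda>k. trig_coeff f k + trig_coeff g k)"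
      using int[OF add.hyps(1)] int[OF add.hyps(2)] 
      by (auto simp: trig_coeff_def M_def[symmetric] distrib_right)
    then show ?case using tendsto_add[OF add.IH] by simp
  next
    case (lim f s)
    have conv: "(\<lambda>i. LINT x|M. cmod (f x - s i x)) \<longlonglongrightarrow> (LINT x|M. 0)"
    proof (rule integral_dominated_convergence[where w = "\<lambda>x. 3 * cmod (f x)"])
      have [measurable]: "f \<in> borel_measurable M" "s i \<in> borel_measurable M" for i using lim by auto
      show "(\<lambda>x. cmod (f x - s i x)) \<in> borel_measurable M" for i by measurable
      show "integrable M (\<lambda>x. 3 * cmod (f x))" using lim by auto
      show "AE x in M. (\<lambda>i. cmod (f x - s i x)) \<longlonglongrightarrow> 0"
      proof (rule AE_I2)
        fix x assume "x \<in> space M"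
        from tendsto_diff[OF tendsto_const[of "f x"] lim.hyps(2)[OF this]]
        show "(\<lambda>i. cmod (f x - s i x)) \<longlonglongrightarrow> 0"
          by (intro tendsto_norm_zero) simp
      qed
      show "AE x in M. norm (cmod (f x - s i x)) \<le> 3 * cmod (f x)" for i
      proof (rule AE_I2)
        fix x assume "x \<in> space M"
        then show "norm (cmod (f x - s i x)) \<le> 3 * cmod (f x)"
          using lim.hyps(3)[of x i] norm_triangle_ineq4[of "f x" "s i x"] by simp
      qed
    qed auto
    show ?case
    proof (rule LIMSEQ_I)
      fix r :: real assume r: "r > 0"
      have "eventually (\<lambda>i. (LINT x|M. cmod (f x - s i x)) < r / 2) sequentially"
        using order_tendstoD(2)[OF conv, of "r/2"] r by simp
      then obtain i where i: "(LINT x|M. cmod (f x - s i x)) < r / 2"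
        using eventually_happens trivial_limit_sequentially by blast
      obtain K where K: "\<And>k. k \<ge> K \<Longrightarrow> cmod (trig_coeff (s i) k) < r / 2"
        using LIMSEQ_D[OF lim.IH[of i], of "r/2"] r by auto
      have "cmod (trig_coeff f k - 0) < r" if "k \<ge> K" for k
      proof -
        have "cmod (trig_coeff f k - trig_coeff (s i) k) \<le> (LINT x|M. cmod (f x - s i x))"
          unfolding diff[OF lim.hyps(4) lim.hyps(1)]
          by (rule order_trans[OF integral_norm_bound]) (simp add: norm_mult)
        then show ?thesis
          using i K[OF that] norm_triangle_sub[of "trig_coeff f k" "trig_coeff (s i) k"] by simp
      qed
      then show "\<exists>no. \<forall>n\<ge>no. cmod (trig_coeff f n - 0) < r" by blast
    qed
  qed
qed

text \<open>
  The interval of integration may be shorter than the period of the exponentials, since \<open>f\<close> can be cut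
  off; this makes primitives of modulated functions tend to zero pointwise.
\<close>
lemma riemann_lebesgue:
  fixes f :: "real \<Rightarrow> complex"
  assumes f: "f absolutely_integrable_on {0..1}" and x: "0 \<le> x" "x \<le> 1"
  shows "(\<lambda>k. integral {0..x} (\<lambda>t. f t * cis (- (2 * pi * real k * t)))) \<longlonglongrightarrow> 0"
proof -
  define g where "g = (\<lambda>t. if t \<in> {0..x} then f t else 0)"
  have sub: "{0..x} \<subseteq> {0..1}" using x by auto
  have "f absolutely_integrable_on {0..x}"
    using absolutely_integrable_on_subinterval[OF f sub] .
  moreover have "(\<lambda>t. indicat_real {0..1} t *\<^sub>R g t) = (\<lambda>t. indicat_real {0..x} t *\<^sub>R f t)"
    using sub by (auto simp: g_def indicator_def)
  ultimately have g: "g absolutely_integrable_on {0..1}"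
    by (simp add: set_integrable_def)
  have "trig_coeff g k = integral {0..x} (\<lambda>t. f t * cis (- (2 * pi * real k * t)))" for k
  proof -
    have c: "continuous_on {0..1} (\<lambda>t. cis (- (2 * pi * real k * t)))"
      by (intro continuous_intros)
    have "(\<lambda>t. g t * cis (- (2 * pi * real k * t))) absolutely_integrable_on {0..1}"
      using absolutely_integrable_continuous_mult[OF c g] by (simp add: mult.commute)
    then have "trig_coeff g k = integral {0..1} (\<lambda>t. g t * cis (- (2 * pi * real k * t)))"
      unfolding trig_coeff_def by (intro lebesgue_integral_eq_integral absolutely_integrable_imp_integrable) auto
    also have "\<dots> = integral {0..1} (\<lambda>t. if t \<in> {0..x} then f t * cis (- (2 * pi * real k * t)) else 0)"
      by (intro Henstock_Kurzweil_Integration.integral_cong) (auto simp: g_def)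
    also have "\<dots> = integral {0..x} (\<lambda>t. f t * cis (- (2 * pi * real k * t)))"
      by (subst integral_restrict_Int) (simp only: Int_absorb2[OF sub])
    finally show ?thesis .
  qed
  then have "trig_coeff g = (\<lambda>k. integral {0..x} (\<lambda>t. f t * cis (- (2 * pi * real k * t))))"
    by (rule ext)
  moreover have "trig_coeff g \<longlonglongrightarrow> 0"
    by (rule trig_coeff_tendsto_0[OF absolutely_integrable_imp_integrable[OF g]]) simp
  ultimately show ?thesis by (simp only:)
qed

section \<open>Real eigenfunctions as modulated waves\<close>

lemma abs_cont_deriv_linear:
  assumes h: "bounded_linear h" and F: "abs_cont_deriv F f"
  shows "abs_cont_deriv (\<lambda>x. h (F x)) (\<lambda>x. h (f x))"
  unfolding abs_cont_deriv_def
proof (intro conjI ballI)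
  show "(\<lambda>x. h (f x)) absolutely_integrable_on {0..1}"
    using absolutely_integrable_linear[OF abs_cont_deriv_integrable(1)[OF F order_refl order_refl] h]
    by (simp add: o_def)
  fix x :: real assume x: "x \<in> {0..1}"
  then have "f integrable_on {0..x}"
    using abs_cont_deriv_integrable(2)[OF F, of 0 x] by simp
  then have "integral {0..x} (\<lambda>x. h (f x)) = h (integral {0..x} f)"
    using integral_linear[OF _ h] by (simp add: o_def)
  then show "h (F x) = h (F 0) + integral {0..x} (\<lambda>x. h (f x))"
    using abs_cont_derivD[OF F x] linear_add[OF bounded_linear.linear[OF h]] by metis
qed

lemma abs_cont_deriv_add:
  assumes F: "abs_cont_deriv F f" and G: "abs_cont_deriv G g"
  shows "abs_cont_deriv (\<lambda>x. F x + G x) (\<lambda>x. f x + g x)"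
  unfolding abs_cont_deriv_def
proof (intro conjI ballI)
  show "(\<lambda>x. f x + g x) absolutely_integrable_on {0..1}"
    by (intro set_integral_add abs_cont_deriv_integrable(1)[OF F] abs_cont_deriv_integrable(1)[OF G]) auto
  fix x :: real assume x: "x \<in> {0..1}"
  then have "f integrable_on {0..x}" "g integrable_on {0..x}"
    using abs_cont_deriv_integrable(2)[OF F, of 0 x] abs_cont_deriv_integrable(2)[OF G, of 0 x] by simp_all
  then have "integral {0..x} (\<lambda>x. f x + g x) = integral {0..x} f + integral {0..x} g"
    by (rule integral_add)
  then show "F x + G x = F 0 + G 0 + integral {0..x} (\<lambda>x. f x + g x)"
    using abs_cont_derivD[OF F x] abs_cont_derivD[OF G x] by (metis add.assoc add.left_commute)
qed

text \<open>
  A differential equation in Caratheodory's sense fixes the second derivative only almost everywhere;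
  this rule exchanges it for the right-hand side of the equation.
\<close>
lemma abs_cont_deriv_spike:
  assumes F: "abs_cont_deriv F f" and ae: "AE x in lebesgue_on {0..1}. f x = g x"
    and FG: "\<And>x. x \<in> {0..1} \<Longrightarrow> F x = G x"
  shows "abs_cont_deriv G g"
proof -
  obtain N where N': "{x \<in> space (lebesgue_on {0..1}). f x \<noteq> g x} \<subseteq> N"
      "emeasure (lebesgue_on {0..1}) N = 0" "N \<in> sets (lebesgue_on {0..1})"
    using ae by (rule AE_E)
  then have N: "N \<in> null_sets (lebesgue_on {0..1})" "{x \<in> {0..1}. f x \<noteq> g x} \<subseteq> N"
    by (auto simp only: null_setsI space_lebesgue_on)
  then have neg: "negligible N"
    by (simp add: negligible_iff_null_sets null_sets_restrict_space)
  have eq: "g x = f x" if "x \<in> {0..1} - N" for x using that N by auto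
  have "g absolutely_integrable_on {0..1}"
    by (rule absolutely_integrable_spike[OF abs_cont_deriv_integrable(1)[OF F order_refl order_refl] neg])
       (use eq in auto)
  moreover have "G x = G 0 + integral {0..x} g" if "x \<in> {0..1}" for x
  proof -
    have "integral {0..x} f = integral {0..x} g"
      by (rule integral_spike[OF neg]) (use that eq in auto)
    then show ?thesis
      using abs_cont_derivD[OF F that] FG[OF that] FG[of 0] by simp
  qed
  ultimately show ?thesis unfolding abs_cont_deriv_def by blast
qed

lemma abs_cont_deriv_cong:
  assumes "abs_cont_deriv F f" "\<And>x. x \<in> {0..1} \<Longrightarrow> f x = g x" "\<And>x. x \<in> {0..1} \<Longrightarrow> F x = G x"
  shows "abs_cont_deriv G g"
  by (rule abs_cont_deriv_spike[OF assms(1)]) (use assms(2,3) in \<open>auto intro!: AE_I2\<close>)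

lemma abs_cont_deriv_cis: "abs_cont_deriv (\<lambda>x. cis (c * x)) (\<lambda>x. \<i> * of_real c * cis (c * x))"
  unfolding abs_cont_deriv_def
proof (intro conjI ballI)
  show "(\<lambda>x. \<i> * of_real c * cis (c * x)) absolutely_integrable_on {0..1}"
    by (intro absolutely_integrable_continuous_real continuous_intros)
  fix x :: real assume "x \<in> {0..1}"
  then have "((\<lambda>x. \<i> * of_real c * cis (c * x)) has_integral (cis (c * x) - cis (c * 0))) {0..x}"
    by (intro fundamental_theorem_of_calculus has_vector_derivative_cis_linear) auto
  then have "integral {0..x} (\<lambda>x. \<i> * of_real c * cis (c * x)) = cis (c * x) - cis (c * 0)"
    by (rule integral_unique)
  then show "cis (c * x) = cis (c * 0) + integral {0..x} (\<lambda>x. \<i> * of_real c * cis (c * x))"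
    by (metis add.commute diff_add_cancel)
qed

lemma abs_cont_deriv_indefinite_integral:
  "f absolutely_integrable_on {0..1} \<Longrightarrow> abs_cont_deriv (\<lambda>x. integral {0..x} f) f"
  unfolding abs_cont_deriv_def by simp

lemma integral_by_parts_abs_cont:
  assumes F: "abs_cont_deriv F f" and G: "abs_cont_deriv G g" and bd: "F 1 * G 1 = F 0 * G 0"
  shows "integral {0..1} (\<lambda>x. F x * g x) = - integral {0..1} (\<lambda>x. G x * f x)"
proof -
  have "(\<lambda>x. F x * g x) integrable_on {0..1}" "(\<lambda>x. G x * f x) integrable_on {0..1}"
    using absolutely_integrable_continuous_mult[OF abs_cont_deriv_continuous[OF F] abs_cont_deriv_integrable(1)[OF G order_refl order_refl]]
      absolutely_integrable_continuous_mult[OF abs_cont_deriv_continuous[OF G] abs_cont_deriv_integrable(1)[OF F order_refl order_refl]]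
      set_lebesgue_integral_eq_integral(1) by blast+
  then have "integral {0..1} (\<lambda>x. F x * g x) + integral {0..1} (\<lambda>x. G x * f x)
      = integral {0..1} (\<lambda>x. F x * g x + G x * f x)"
    by (rule integral_add[symmetric])
  also have "\<dots> = F 1 * G 1 - F 0 * G 0"
    using abs_cont_deriv_diff_eq[OF abs_cont_deriv_mult[OF F G], of 0 1] by simp
  finally show ?thesis using bd by (simp add: add_eq_0_iff)
qed

text \<open>
  The derivative of a real eigenfunction comes as a complex function. Its real part serves equally
  well, because the real part commutes with the integral.
\<close>
lemma real_eigenfunction_system:
  assumes ef: "eigenfunction q (of_real m) (\<lambda>x. of_real (\<Phi> x))"
  obtains p where
    "abs_cont_deriv (\<lambda>x. of_real (\<Phi> x)) (\<lambda>x. of_real (p x))"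
    "abs_cont_deriv (\<lambda>x. of_real (p x)) (\<lambda>x. of_real ((q x - m) * \<Phi> x))"
    "\<Phi> 1 = - \<Phi> 0" "p 1 = - p 0"
proof -
  from ef obtain y1 y2 where y: "abs_cont_deriv (\<lambda>x. of_real (\<Phi> x)) y1" "abs_cont_deriv y1 y2"
    "complex_of_real (\<Phi> 1) = - of_real (\<Phi> 0)" "y1 1 = - y1 0"
    "AE x in lebesgue_on {0..1}. of_real m * of_real (\<Phi> x) = - y2 x + complex_of_real (q x) * of_real (\<Phi> x)"
    unfolding eigenfunction_def L_antiper_def by blast
  have bl: "bounded_linear (\<lambda>z. complex_of_real (Re z))"
    by (rule bounded_linear_compose[OF bounded_linear_of_real bounded_linear_Re])
  show ?thesis
  proof (rule that[of "\<lambda>x. Re (y1 x)"])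
    show "abs_cont_deriv (\<lambda>x. of_real (\<Phi> x)) (\<lambda>x. of_real (Re (y1 x)))"
      using abs_cont_deriv_linear[OF bl y(1)] by simp
    show "abs_cont_deriv (\<lambda>x. of_real (Re (y1 x))) (\<lambda>x. of_real ((q x - m) * \<Phi> x))"
    proof (rule abs_cont_deriv_spike[OF abs_cont_deriv_linear[OF bl y(2)] _ refl])
      show "AE x in lebesgue_on {0..1}. complex_of_real (Re (y2 x)) = of_real ((q x - m) * \<Phi> x)"
        using y(5)
      proof eventually_elim
        case (elim x)
        then have "y2 x = of_real (q x) * of_real (\<Phi> x) - of_real m * of_real (\<Phi> x)"
          by (simp add: algebra_simps)
        also have "\<dots> = of_real ((q x - m) * \<Phi> x)" by (simp add: algebra_simps)
        finally show ?case by simp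
      qed
    qed
    show "\<Phi> 1 = - \<Phi> 0" using y(3) by (metis of_real_eq_iff of_real_minus)
    show "Re (y1 1) = - Re (y1 0)" using y(4) by simp
  qed
qed

lemma integrable_continuous_mult_L1:
  fixes F g :: "real \<Rightarrow> complex"
  assumes "continuous_on {0..1} F" "g absolutely_integrable_on {0..1}"
  shows "(\<lambda>x. F x * g x) integrable_on {0..1}"
  using absolutely_integrable_continuous_mult[OF assms] set_lebesgue_integral_eq_integral(1) by blast

text \<open>
  Two integrations by parts, one for each equation. Their boundary terms vanish because a product of two
  antiperiodic functions is periodic, and the terms with \<open>q\<close> and with the derivatives are symmetric in
  the two functions and cancel.
\<close>
lemma eigenfunctions_orthogonal:
  assumes q: "q absolutely_integrable_on {0..1}"
    and ef1: "eigenfunction q (of_real m1) (\<lambda>x. of_real (\<Phi>1 x))"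
    and ef2: "eigenfunction q (of_real m2) (\<lambda>x. of_real (\<Phi>2 x))"
    and ne: "m1 \<noteq> m2"
  shows "L2_inner (\<lambda>x. of_real (\<Phi>1 x)) (\<lambda>x. of_real (\<Phi>2 x)) = 0"
proof -
  obtain p1 where p1: "abs_cont_deriv (\<lambda>x. of_real (\<Phi>1 x)) (\<lambda>x. of_real (p1 x))"
    "abs_cont_deriv (\<lambda>x. of_real (p1 x)) (\<lambda>x. of_real ((q x - m1) * \<Phi>1 x))"
    "\<Phi>1 1 = - \<Phi>1 0" "p1 1 = - p1 0" using real_eigenfunction_system[OF ef1] .
  obtain p2 where p2: "abs_cont_deriv (\<lambda>x. of_real (\<Phi>2 x)) (\<lambda>x. of_real (p2 x))"
    "abs_cont_deriv (\<lambda>x. of_real (p2 x)) (\<lambda>x. of_real ((q x - m2) * \<Phi>2 x))"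
    "\<Phi>2 1 = - \<Phi>2 0" "p2 1 = - p2 0" using real_eigenfunction_system[OF ef2] .
  note c1 = abs_cont_deriv_continuous[OF p1(1)] and c2 = abs_cont_deriv_continuous[OF p2(1)]
  note i1 = integrable_continuous_mult_L1[OF c2 abs_cont_deriv_integrable(1)[OF p1(2) order_refl order_refl]]
    and i2 = integrable_continuous_mult_L1[OF c1 abs_cont_deriv_integrable(1)[OF p2(2) order_refl order_refl]]
  have 1: "integral {0..1} (\<lambda>x. of_real (\<Phi>2 x) * complex_of_real ((q x - m1) * \<Phi>1 x))
      = - integral {0..1} (\<lambda>x. of_real (p1 x) * of_real (p2 x))"
    by (rule integral_by_parts_abs_cont[OF p2(1) p1(2)]) (simp add: p1 p2)
  have 2: "integral {0..1} (\<lambda>x. of_real (\<Phi>1 x) * complex_of_real ((q x - m2) * \<Phi>2 x))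
      = - integral {0..1} (\<lambda>x. of_real (p2 x) * of_real (p1 x))"
    by (rule integral_by_parts_abs_cont[OF p1(1) p2(2)]) (simp add: p1 p2)
  have "of_real (m2 - m1) * L2_inner (\<lambda>x. of_real (\<Phi>1 x)) (\<lambda>x. of_real (\<Phi>2 x))
      = integral {0..1} (\<lambda>x. of_real (m2 - m1) * (complex_of_real (\<Phi>1 x) * of_real (\<Phi>2 x)))"
    by (simp add: L2_inner_def)
  also have "\<dots> = integral {0..1} (\<lambda>x. of_real (\<Phi>2 x) * complex_of_real ((q x - m1) * \<Phi>1 x)
        - of_real (\<Phi>1 x) * complex_of_real ((q x - m2) * \<Phi>2 x))"
    by (intro Henstock_Kurzweil_Integration.integral_cong) (simp add: algebra_simps)
  also have "\<dots> = 0"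
    unfolding integral_diff[OF i1 i2] 1 2 by (simp add: mult.commute)
  finally show ?thesis using ne by simp
qed

text \<open>
  Variation of constants: \<open>z = \<Phi>' + i w \<Phi>\<close> satisfies \<open>z' = i w z + (q - (m - w\<^sup>2)) \<Phi>\<close>, so
  \<open>e\<^bsup>- i w x\<^esup> z\<close> has a derivative without the factor \<open>w\<close>. Both \<open>z\<close> and \<open>e\<^bsup>- i w x\<^esup>\<close> change sign over the
  interval, which makes the amplitude periodic.
\<close>
lemma eigenfunction_amplitude:
  fixes w m :: real
  assumes ef: "eigenfunction q (of_real m) (\<lambda>x. of_real (\<Phi> x))"
    and w: "w > 0" "cis w = - 1"
  obtains a where
    "abs_cont_deriv a (\<lambda>x. of_real (q x - (m - w\<^sup>2)) * (of_real (\<Phi> x) * cis (- w * x)) / (2 * \<i> * of_real w))"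
    "\<And>x. x \<in> {0..1} \<Longrightarrow> of_real (\<Phi> x) = a x * cis (w * x) + cnj (a x) * cis (- w * x)"
    "a 1 = a 0"
proof -
  obtain p where p: "abs_cont_deriv (\<lambda>x. of_real (\<Phi> x)) (\<lambda>x. of_real (p x))"
    "abs_cont_deriv (\<lambda>x. of_real (p x)) (\<lambda>x. of_real ((q x - m) * \<Phi> x))"
    "\<Phi> 1 = - \<Phi> 0" "p 1 = - p 0" using real_eigenfunction_system[OF ef] .
  define z where "z = (\<lambda>x. complex_of_real (p x) + \<i> * of_real w * of_real (\<Phi> x))"
  define a where "a = (\<lambda>x. (1 / (2 * \<i> * of_real w)) * (cis (- w * x) * z x))"
  have z: "abs_cont_deriv z (\<lambda>x. of_real ((q x - m) * \<Phi> x) + \<i> * of_real w * of_real (p x))"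
    unfolding z_def
    by (intro abs_cont_deriv_add p(2) abs_cont_deriv_linear[OF bounded_linear_mult_right p(1)])
  have w0: "complex_of_real w \<noteq> 0" using w by simp
  have cis1: "cis (- w) = - 1" using w(2) by (metis cis_cnj complex_cnj_minus complex_cnj_one)
  show ?thesis
  proof (rule that)
    show "abs_cont_deriv a (\<lambda>x. of_real (q x - (m - w\<^sup>2)) * (of_real (\<Phi> x) * cis (- w * x)) / (2 * \<i> * of_real w))"
      unfolding a_def
    proof (rule abs_cont_deriv_cong[OF abs_cont_deriv_linear[OF bounded_linear_mult_right
              abs_cont_deriv_mult[OF abs_cont_deriv_cis z]] _ refl])
      fix x :: real
      have "cis (- w * x) * (of_real ((q x - m) * \<Phi> x) + \<i> * of_real w * of_real (p x))
           + z x * (\<i> * of_real (- w) * cis (- w * x))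
         = of_real (q x - (m - w\<^sup>2)) * (of_real (\<Phi> x) * cis (- w * x))"
        by (simp add: z_def algebra_simps power2_eq_square)
      then show "1 / (2 * \<i> * of_real w) *
          (cis (- w * x) * (of_real ((q x - m) * \<Phi> x) + \<i> * of_real w * of_real (p x))
            + z x * (\<i> * of_real (- w) * cis (- w * x)))
         = of_real (q x - (m - w\<^sup>2)) * (of_real (\<Phi> x) * cis (- w * x)) / (2 * \<i> * of_real w)"
        by simp
    qed
    have c: "cis (- w * x) * cis (w * x) = 1" for x by (simp add: cis_mult)
    show "of_real (\<Phi> x) = a x * cis (w * x) + cnj (a x) * cis (- w * x)" for x
    proof -
      have "a x * cis (w * x) = z x / (2 * \<i> * of_real w)"
        using c[of x] by (simp add: a_def field_simps)
      moreover have "cnj (a x) * cis (- w * x) = - cnj (z x) / (2 * \<i> * of_real w)"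
        using c[of x] by (simp add: a_def cis_cnj field_simps)
      ultimately have "a x * cis (w * x) + cnj (a x) * cis (- w * x) = (z x - cnj (z x)) / (2 * \<i> * of_real w)"
        by (simp add: diff_divide_distrib)
      also have "\<dots> = of_real (\<Phi> x)" using w0 by (simp add: z_def field_simps)
      finally show ?thesis by simp
    qed
    show "a 1 = a 0" using p(3,4) cis1 by (simp add: a_def z_def)
  qed
qed

section \<open>Standing waves with slowly varying amplitude\<close>

definition l1_norm :: "(real \<Rightarrow> complex) \<Rightarrow> real" where
  "l1_norm q = integral {0..1} (\<lambda>x. cmod (q x))"

text \<open>
  A bound for the relative oscillation of the amplitude of a wave with frequency \<open>w\<close> and spectral
  shift \<open>d\<close>.
\<close>
definition wave_defect :: "(real \<Rightarrow> complex) \<Rightarrow> real \<Rightarrow> real \<Rightarrow> real" where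
  "wave_defect q w d = (l1_norm q + \<bar>d\<bar>) / w"

definition wave_coeff :: "(real \<Rightarrow> real) \<Rightarrow> real \<Rightarrow> complex" where
  "wave_coeff \<Phi> w = integral {0..1} (\<lambda>x. of_real (\<Phi> x) * cis (- w * x))"

text \<open>
  For \<open>w = (2 n + 1) \<pi>\<close> this is the Fourier coefficient of \<open>q\<close> with index \<open>2 n + 1\<close>. It couples the
  two exponentials \<open>e\<^bsup>i w x\<^esup>\<close> and \<open>e\<^bsup>- i w x\<^esup>\<close>.
\<close>
definition resonant_coeff :: "(real \<Rightarrow> complex) \<Rightarrow> real \<Rightarrow> complex" where
  "resonant_coeff q w = integral {0..1} (\<lambda>x. q x * cis (- (2 * w) * x))"

definition primitive :: "(real \<Rightarrow> complex) \<Rightarrow> real \<Rightarrow> complex" where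
  "primitive q x = integral {0..x} q"

definition modulated_primitive :: "(real \<Rightarrow> complex) \<Rightarrow> real \<Rightarrow> real \<Rightarrow> complex" where
  "modulated_primitive q w x = integral {0..x} (\<lambda>t. q t * cis (- (2 * w) * t))"

text \<open>
  What remains of an eigenfunction once its amplitude is known: the equation for the amplitude and its
  periodicity. As \<open>w\<close> is a positive multiple of \<open>\<pi>\<close>, the exponentials \<open>e\<^bsup>i 2 w x\<^esup>\<close> and \<open>e\<^bsup>- i 2 w x\<^esup>\<close> have mean
  zero. All estimates are explicit inequalities for one frequency; limits are taken afterwards.
\<close>
locale standing_wave =
  fixes q :: "real \<Rightarrow> complex" and \<Phi> :: "real \<Rightarrow> real" and a :: "real \<Rightarrow> complex" and w d :: real and k :: nat
  assumes q: "q absolutely_integrable_on {0..1}"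
    and k: "k > 0" and w: "w = pi * real k"
    and deriv: "abs_cont_deriv a (\<lambda>x. (q x - of_real d) * (of_real (\<Phi> x) * cis (- w * x)) / (2 * \<i> * of_real w))"
    and wave: "\<And>x. x \<in> {0..1} \<Longrightarrow> of_real (\<Phi> x) = a x * cis (w * x) + cnj (a x) * cis (- w * x)"
    and closed: "a 1 = a 0"
begin

abbreviation "K \<equiv> l1_norm q"
abbreviation "eps \<equiv> wave_defect q w d"
abbreviation "v \<equiv> wave_coeff \<Phi> w"
abbreviation "qhat \<equiv> resonant_coeff q w"
abbreviation "Q \<equiv> primitive q"
abbreviation "S \<equiv> modulated_primitive q w"

lemma w_pos: "w > 0" using k w by simp
lemma K_nonneg: "K \<ge> 0" unfolding l1_norm_def
  by (rule integral_nonneg) (use q in \<open>auto simp: absolutely_integrable_on_def\<close>)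
lemma eps_nonneg: "eps \<ge> 0" using K_nonneg w_pos by (simp add: wave_defect_def)

lemma integral_cis_wave:
  "integral {0..1} (\<lambda>x. cis (2 * w * x)) = 0" "integral {0..1} (\<lambda>x. cis (- (2 * w) * x)) = 0"
  using integral_cis_period[of "int k"] integral_cis_period[of "- int k"] k w
  by (simp_all add: mult_ac)

lemma continuous_a: "continuous_on {0..1} a"
  by (rule abs_cont_deriv_continuous[OF deriv])

lemma continuous_cis [continuous_intros]: "continuous_on A (\<lambda>x. cis (c * x))"
  by (intro continuous_intros)

lemma absolutely_integrable_mult_cis:
  "g absolutely_integrable_on {0..1} \<Longrightarrow> (\<lambda>x. g x * cis (c * x)) absolutely_integrable_on {0..1}"
  by (subst mult.commute) (rule absolutely_integrable_continuous_mult[OF continuous_cis])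

lemma wave_mult_cis:
  assumes "x \<in> {0..1}"
  shows "of_real (\<Phi> x) * cis (- w * x) = a x + cnj (a x) * cis (- (2 * w) * x)"
proof -
  have "cis (w * x) * cis (- w * x) = 1" "cis (- w * x) * cis (- w * x) = cis (- (2 * w) * x)"
    by (simp_all add: cis_mult algebra_simps)
  then show ?thesis unfolding wave[OF assms] by (simp only: distrib_right mult.assoc mult_1_right)
qed

lemma cmod_wave_le:
  assumes "x \<in> {0..1}"
  shows "cmod (of_real (\<Phi> x) * cis (- w * x)) \<le> 2 * cmod (a x)"
  unfolding wave_mult_cis[OF assms]
  using norm_triangle_ineq[of "a x" "cnj (a x) * cis (- (2 * w) * x)"] by (simp add: norm_mult)

lemma continuous_wave_cis: "continuous_on {0..1} (\<lambda>x. of_real (\<Phi> x) * cis (- w * x))"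
proof -
  have "continuous_on {0..1} (\<lambda>x. a x + cnj (a x) * cis (- (2 * w) * x))"
    by (intro continuous_intros continuous_a)
  then show ?thesis by (rule continuous_on_eq) (rule wave_mult_cis[symmetric])
qed

lemma q_minus_d: "(\<lambda>x. q x - of_real d) absolutely_integrable_on {0..1}"
  by (intro set_integral_diff q absolutely_integrable_continuous_real continuous_intros)

lemma integral_norm_q_minus_d_le: "integral {0..1} (\<lambda>x. cmod (q x - of_real d)) \<le> K + \<bar>d\<bar>"
proof -
  have i: "(\<lambda>x. cmod (q x)) integrable_on {0..1}" "(\<lambda>x. cmod (q x - of_real d)) integrable_on {0..1}"
    using q q_minus_d by (auto simp: absolutely_integrable_on_def)
  have "integral {0..1} (\<lambda>x. cmod (q x - of_real d)) \<le> integral {0..1} (\<lambda>x. cmod (q x) + \<bar>d\<bar>)"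
  proof (rule integral_le)
    show "(\<lambda>x. cmod (q x) + \<bar>d\<bar>) integrable_on {0..1}"
      using i(1) by (intro integrable_add) auto
    show "cmod (q x - of_real d) \<le> cmod (q x) + \<bar>d\<bar>" for x
      using norm_triangle_ineq4[of "q x" "of_real d"] by simp
  qed (use i in auto)
  also have "\<dots> = K + \<bar>d\<bar>" using integral_add[OF i(1) integrable_const_ivl[of "\<bar>d\<bar>" 0 1]] by (simp add: l1_norm_def)
  finally show ?thesis .
qed

lemma amplitude_oscillation:
  assumes M: "\<And>x. x \<in> {0..1} \<Longrightarrow> cmod (a x) \<le> M" and x: "x \<in> {0..1}"
  shows "cmod (a x - a 0) \<le> eps * M"
proof -
  have sub: "{0..x} \<subseteq> {0..1}" using x by auto
  have M0: "M \<ge> 0" using M[of 0] norm_ge_zero[of "a 0"] by (meson atLeastAtMost_iff order.refl order_trans zero_le_one)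
  have "a x - a 0 = integral {0..x} (\<lambda>x. of_real (\<Phi> x) * cis (- w * x) / (2 * \<i> * of_real w) * (q x - of_real d))"
    using abs_cont_deriv_diff_eq[OF deriv, of 0 x] x by (simp add: mult_ac)
  also have "cmod \<dots> \<le> M / w * integral {0..x} (\<lambda>x. cmod (q x - of_real d))"
  proof (rule norm_integral_mult_le)
    show "continuous_on {0..x} (\<lambda>x. of_real (\<Phi> x) * cis (- w * x) / (2 * \<i> * of_real w))"
      using w_pos by (intro continuous_intros continuous_on_subset[OF continuous_wave_cis sub]) auto
    show "(\<lambda>x. q x - of_real d) absolutely_integrable_on {0..x}"
      using absolutely_integrable_on_subinterval[OF q_minus_d sub] .
    fix t assume "t \<in> {0..x}"
    then have t: "t \<in> {0..1}" using sub by auto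
    have "cmod (of_real (\<Phi> t) * cis (- w * t)) \<le> 2 * M"
      using cmod_wave_le[OF t] M[OF t] by linarith
    then show "cmod (of_real (\<Phi> t) * cis (- w * t) / (2 * \<i> * of_real w)) \<le> M / w"
      using w_pos by (simp add: norm_divide norm_mult field_simps)
  qed
  also have "\<dots> \<le> M / w * (K + \<bar>d\<bar>)"
  proof (rule mult_left_mono)
    have "integral {0..x} (\<lambda>x. cmod (q x - of_real d)) \<le> integral {0..1} (\<lambda>x. cmod (q x - of_real d))"
      by (rule integral_subset_le[OF sub])
         (use absolutely_integrable_on_subinterval[OF q_minus_d sub] q_minus_d in \<open>auto simp: absolutely_integrable_on_def\<close>)
    then show "integral {0..x} (\<lambda>x. cmod (q x - of_real d)) \<le> K + \<bar>d\<bar>"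
      using integral_norm_q_minus_d_le by linarith
  qed (use M0 w_pos in auto)
  also have "\<dots> = eps * M" by (simp add: wave_defect_def)
  finally show ?thesis .
qed

text \<open>
  The oscillation bound contains the maximum of the amplitude itself; when \<open>eps\<close> is at most one half,
  that maximum can be absorbed into the left-hand side.
\<close>
lemma amplitude_almost_constant:
  assumes e: "eps \<le> 1/2" and x: "x \<in> {0..1}"
  shows "cmod (a x) \<le> 2 * cmod (a 0)" "cmod (a x - a 0) \<le> 2 * eps * cmod (a 0)"
proof -
  have "continuous_on {0..1} (\<lambda>x. cmod (a x))" by (intro continuous_intros continuous_a)
  then obtain y where y: "y \<in> {0..1}" "\<And>x. x \<in> {0..1} \<Longrightarrow> cmod (a x) \<le> cmod (a y)"
    using continuous_attains_sup[of "{0..1::real}" "\<lambda>x. cmod (a x)"] by auto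
  have "cmod (a y) \<le> cmod (a 0) + cmod (a y - a 0)" by (rule norm_triangle_sub)
  also have "cmod (a y - a 0) \<le> eps * cmod (a y)"
    by (rule amplitude_oscillation[OF y(2) y(1)])
  also have "\<dots> \<le> 1/2 * cmod (a y)" by (rule mult_right_mono[OF e]) simp
  finally have *: "cmod (a y) \<le> 2 * cmod (a 0)" by simp
  show "cmod (a x) \<le> 2 * cmod (a 0)" using y(2)[OF x] * by linarith
  have "cmod (a x - a 0) \<le> eps * (2 * cmod (a 0))"
    by (rule amplitude_oscillation[OF order_trans[OF y(2) *] x])
  then show "cmod (a x - a 0) \<le> 2 * eps * cmod (a 0)" by simp
qed

lemma norm_integral_amplitude_le:
  assumes e: "eps \<le> 1/2" and g: "g absolutely_integrable_on {0..1}"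
  shows "cmod (integral {0..1} (\<lambda>x. (a x - a 0) * g x)) \<le> 2 * eps * cmod (a 0) * integral {0..1} (\<lambda>x. cmod (g x))"
    "cmod (integral {0..1} (\<lambda>x. cnj (a x - a 0) * g x)) \<le> 2 * eps * cmod (a 0) * integral {0..1} (\<lambda>x. cmod (g x))"
  by (rule norm_integral_mult_le[OF _ g],
      intro continuous_intros continuous_a,
      use amplitude_almost_constant(2)[OF e] in \<open>simp flip: complex_cnj_diff\<close>)+

text \<open>
  The first two terms are those of a wave with constant amplitude \<open>a 0\<close>, the other two the corrections
  for its variation.
\<close>
lemma integral_mult_wave:
  assumes g: "g absolutely_integrable_on {0..1}"
  shows "integral {0..1} (\<lambda>x. of_real (\<Phi> x) * cis (- w * x) * g x)
    = a 0 * integral {0..1} g + cnj (a 0) * integral {0..1} (\<lambda>x. g x * cis (- (2 * w) * x))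
      + integral {0..1} (\<lambda>x. (a x - a 0) * g x)
      + integral {0..1} (\<lambda>x. cnj (a x - a 0) * (g x * cis (- (2 * w) * x)))"
proof -
  have gc: "(\<lambda>x. g x * cis (- (2 * w) * x)) absolutely_integrable_on {0..1}"
    by (rule absolutely_integrable_mult_cis[OF g])
  have i: "g integrable_on {0..1}" "(\<lambda>x. g x * cis (- (2 * w) * x)) integrable_on {0..1}"
    using g gc set_lebesgue_integral_eq_integral(1) by blast+
  have j: "(\<lambda>x. (a x - a 0) * g x) integrable_on {0..1}"
    "(\<lambda>x. cnj (a x - a 0) * (g x * cis (- (2 * w) * x))) integrable_on {0..1}"
    by (intro integrable_continuous_mult_L1 g gc continuous_intros continuous_a)+
  have "integral {0..1} (\<lambda>x. of_real (\<Phi> x) * cis (- w * x) * g x)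
     = integral {0..1} (\<lambda>x. (a 0 * g x + cnj (a 0) * (g x * cis (- (2 * w) * x)) + (a x - a 0) * g x)
         + cnj (a x - a 0) * (g x * cis (- (2 * w) * x)))"
    by (intro Henstock_Kurzweil_Integration.integral_cong, unfold wave_mult_cis) (simp add: algebra_simps)
  also have "\<dots> = integral {0..1} (\<lambda>x. a 0 * g x) + integral {0..1} (\<lambda>x. cnj (a 0) * (g x * cis (- (2 * w) * x)))
      + integral {0..1} (\<lambda>x. (a x - a 0) * g x)
      + integral {0..1} (\<lambda>x. cnj (a x - a 0) * (g x * cis (- (2 * w) * x)))"
    using integrable_on_mult_right[OF i(1), of "a 0"] integrable_on_mult_right[OF i(2), of "cnj (a 0)"] j
    by (simp add: integral_add integrable_add)
  finally show ?thesis by simp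
qed

lemma norm_integral_mult_wave_le:
  assumes e: "eps \<le> 1/2" and g: "g absolutely_integrable_on {0..1}"
  shows "cmod (integral {0..1} (\<lambda>x. of_real (\<Phi> x) * cis (- w * x) * g x)
      - a 0 * integral {0..1} g - cnj (a 0) * integral {0..1} (\<lambda>x. g x * cis (- (2 * w) * x)))
    \<le> 4 * eps * cmod (a 0) * integral {0..1} (\<lambda>x. cmod (g x))"
proof -
  have gc: "(\<lambda>x. g x * cis (- (2 * w) * x)) absolutely_integrable_on {0..1}"
    by (rule absolutely_integrable_mult_cis[OF g])
  have "cmod (u + r) \<le> 4 * z" if "cmod u \<le> 2 * z" "cmod r \<le> 2 * z" for u r :: complex and z :: real
    using that norm_triangle_ineq[of u r] by linarith
  then have "cmod (integral {0..1} (\<lambda>x. (a x - a 0) * g x)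
      + integral {0..1} (\<lambda>x. cnj (a x - a 0) * (g x * cis (- (2 * w) * x))))
    \<le> 4 * (eps * cmod (a 0) * integral {0..1} (\<lambda>x. cmod (g x)))"
    using norm_integral_amplitude_le(1)[OF e g] norm_integral_amplitude_le(2)[OF e gc]
    by (simp add: norm_mult mult.assoc)
  then show ?thesis unfolding integral_mult_wave[OF g] by (simp add: mult.assoc)
qed

lemma v_close: 
  assumes e: "eps \<le> 1/2"
  shows "cmod (v - a 0) \<le> 4 * eps * cmod (a 0)"
proof -
  have "(\<lambda>x::real. 1 :: complex) absolutely_integrable_on {0..1}"
    by (intro absolutely_integrable_continuous_real continuous_intros)
  from norm_integral_mult_wave_le[OF e this] show ?thesis
    using integral_cis_wave by (simp add: wave_coeff_def)
qed

text \<open>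
  The amplitude returns to its initial value, so its derivative has integral zero.
\<close>
lemma frequency_shift_eq: "of_real d * v = integral {0..1} (\<lambda>x. of_real (\<Phi> x) * cis (- w * x) * q x)"
proof -
  have i: "(\<lambda>x. of_real (\<Phi> x) * cis (- w * x) * q x) integrable_on {0..1}"
    "(\<lambda>x. of_real (\<Phi> x) * cis (- w * x)) integrable_on {0..1}"
    by (intro integrable_continuous_mult_L1 continuous_wave_cis q integrable_continuous_interval)+
  have "0 = integral {0..1} (\<lambda>x. (q x - of_real d) * (of_real (\<Phi> x) * cis (- w * x)) / (2 * \<i> * of_real w))"
    using abs_cont_deriv_diff_eq[OF deriv, of 0 1] closed by simp
  then have "0 = integral {0..1} (\<lambda>x. (q x - of_real d) * (of_real (\<Phi> x) * cis (- w * x)))"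
    using w_pos by simp
  also have "\<dots> = integral {0..1} (\<lambda>x. of_real (\<Phi> x) * cis (- w * x) * q x - of_real d * (of_real (\<Phi> x) * cis (- w * x)))"
    by (simp add: algebra_simps)
  also have "\<dots> = integral {0..1} (\<lambda>x. of_real (\<Phi> x) * cis (- w * x) * q x) - of_real d * v"
    using integral_diff[OF i(1) integrable_on_mult_right[OF i(2), of "of_real d"]] by (simp add: wave_coeff_def)
  finally show ?thesis by simp
qed

end

locale mean_zero_standing_wave = standing_wave +
  assumes mean_zero: "integral {0..1} q = 0"
begin

text \<open>
  The non-oscillating main term carries the mean of \<open>q\<close> and vanishes, so only the resonant coefficient
  and the variation of the amplitude contribute to the shift \<open>d\<close> of the eigenvalue.
\<close>
lemma frequency_shift_le:
  assumes e: "eps \<le> 1/2"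
  shows "\<bar>d\<bar> * cmod v \<le> (4 * eps * K + cmod qhat) * cmod (a 0)"
proof -
  have "\<bar>d\<bar> * cmod v = cmod (of_real d * v)" by (simp add: norm_mult)
  also have "\<dots> \<le> cmod (of_real d * v - cnj (a 0) * qhat) + cmod (cnj (a 0) * qhat)"
    by (metis diff_add_cancel norm_triangle_ineq)
  also have "cmod (of_real d * v - cnj (a 0) * qhat) \<le> 4 * eps * cmod (a 0) * K"
    using norm_integral_mult_wave_le[OF e q] 
    by (simp add: frequency_shift_eq mean_zero resonant_coeff_def l1_norm_def)
  finally show ?thesis by (simp add: norm_mult algebra_simps)
qed

lemma Q_deriv: "abs_cont_deriv Q q" and S_deriv: "abs_cont_deriv S (\<lambda>t. q t * cis (- (2 * w) * t))"
  unfolding primitive_def modulated_primitive_def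
  by (intro abs_cont_deriv_indefinite_integral absolutely_integrable_mult_cis q)+

lemma Q_ends: "Q 0 = 0" "Q 1 = 0" "S 0 = 0" using mean_zero by (simp_all add: primitive_def modulated_primitive_def)

lemma Q_S_bounded:
  assumes x: "x \<in> {0..1}"
  shows "cmod (Q x) \<le> K" "cmod (S x) \<le> K"
proof -
  have sub: "{0..x} \<subseteq> {0..1}" using x by auto
  have qx: "q absolutely_integrable_on {0..x}" by (rule absolutely_integrable_on_subinterval[OF q sub])
  have *: "integral {0..x} (\<lambda>x. cmod (q x)) \<le> K"
    unfolding l1_norm_def by (rule integral_subset_le[OF sub]) (use q qx in \<open>auto simp: absolutely_integrable_on_def\<close>)
  have "cmod (integral {0..x} (\<lambda>t. 1 * q t)) \<le> 1 * integral {0..x} (\<lambda>x. cmod (q x))"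
    by (rule norm_integral_mult_le[OF _ qx]) (auto intro: continuous_intros)
  then show "cmod (Q x) \<le> K" using * by (simp add: primitive_def)
  have "cmod (integral {0..x} (\<lambda>t. cis (- (2 * w) * t) * q t)) \<le> 1 * integral {0..x} (\<lambda>x. cmod (q x))"
    by (rule norm_integral_mult_le[OF continuous_cis qx]) simp
  then show "cmod (S x) \<le> K" using * by (simp add: modulated_primitive_def mult.commute)
qed

text \<open>
  The integrand is the derivative of half the square of \<open>Q\<close>, and \<open>Q\<close> vanishes at both ends. This
  cancellation improves the size of the remainder from \<open>O(1/w)\<close> to \<open>o(1/w)\<close>.
\<close>
lemma integral_Q_q: "integral {0..1} (\<lambda>x. Q x * q x) = 0"
  using integral_by_parts_abs_cont[OF Q_deriv Q_deriv] by (simp add: Q_ends)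

lemma integral_mult_q_le:
  assumes "continuous_on {0..1} F" "\<And>x. x \<in> {0..1} \<Longrightarrow> cmod (F x) \<le> B"
  shows "integral {0..1} (\<lambda>x. cmod (F x * q x)) \<le> B * K"
proof -
  have "integral {0..1} (\<lambda>x. cmod (F x * q x)) \<le> integral {0..1} (\<lambda>x. B * cmod (q x))"
  proof (rule integral_le)
    show "(\<lambda>x. cmod (F x * q x)) integrable_on {0..1}"
      using absolutely_integrable_continuous_mult[OF assms(1) q] by (simp add: absolutely_integrable_on_def)
    show "(\<lambda>x. B * cmod (q x)) integrable_on {0..1}"
      using q by (intro integrable_on_mult_right) (simp add: absolutely_integrable_on_def)
  qed (use assms(2) in \<open>auto simp: norm_mult intro!: mult_right_mono\<close>)
  then show ?thesis by (simp add: l1_norm_def)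
qed

text \<open>
  Integration by parts moves the derivative to the amplitude and gains \<open>1 / (2 w)\<close>. In the resulting
  integral of \<open>\<Phi> e\<^bsup>- i w x\<^esup>\<close> against \<open>Q q\<close> the non-oscillating part is zero by \<open>integral_Q_q\<close>, and the
  oscillating part is a Fourier coefficient of the integrable function \<open>Q q\<close>.
\<close>
lemma resonant_term_le:
  assumes e: "eps \<le> 1/2"
  shows "2 * w * cmod (integral {0..1} (\<lambda>x. a x * q x))
    \<le> cmod (a 0) * (4 * K\<^sup>2 * eps + cmod (integral {0..1} (\<lambda>x. Q x * q x * cis (- (2 * w) * x))) + 4 * K * \<bar>d\<bar>)"
proof -
  note cQ = abs_cont_deriv_continuous[OF Q_deriv]
  define r where "r = integral {0..1} (\<lambda>x. Q x * q x * cis (- (2 * w) * x))"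
  have Qq: "(\<lambda>x. Q x * q x) absolutely_integrable_on {0..1}"
    by (rule absolutely_integrable_continuous_mult[OF cQ q])
  define I1 where "I1 = integral {0..1} (\<lambda>x. of_real (\<Phi> x) * cis (- w * x) * (Q x * q x))"
  define I2 where "I2 = integral {0..1} (\<lambda>x. of_real (\<Phi> x) * cis (- w * x) * Q x)"
  have i: "(\<lambda>x. of_real (\<Phi> x) * cis (- w * x) * (Q x * q x)) integrable_on {0..1}"
    "(\<lambda>x. of_real (\<Phi> x) * cis (- w * x) * Q x) integrable_on {0..1}"
    by (intro integrable_continuous_mult_L1 continuous_wave_cis Qq integrable_continuous_interval continuous_intros cQ)+
  have "integral {0..1} (\<lambda>x. a x * q x)
      = - integral {0..1} (\<lambda>x. Q x * ((q x - of_real d) * (of_real (\<Phi> x) * cis (- w * x)) / (2 * \<i> * of_real w)))"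
    by (rule integral_by_parts_abs_cont[OF deriv Q_deriv]) (simp add: Q_ends)
  also have "\<dots> = - integral {0..1} (\<lambda>x. (of_real (\<Phi> x) * cis (- w * x) * (Q x * q x)
      - of_real d * (of_real (\<Phi> x) * cis (- w * x) * Q x)) / (2 * \<i> * of_real w))"
    by (simp add: algebra_simps)
  also have "\<dots> = - ((I1 - of_real d * I2) / (2 * \<i> * of_real w))"
    using integral_diff[OF i(1) integrable_on_mult_right[OF i(2), of "of_real d"]] by (simp add: I1_def I2_def)
  finally have "2 * w * cmod (integral {0..1} (\<lambda>x. a x * q x)) = cmod (I1 - of_real d * I2)"
    using w_pos by (simp add: norm_divide norm_mult norm_minus_commute)
  also have "\<dots> \<le> cmod I1 + \<bar>d\<bar> * cmod I2"
    using norm_triangle_ineq4[of I1 "of_real d * I2"] by (simp add: norm_mult)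
  finally have total: "2 * w * cmod (integral {0..1} (\<lambda>x. a x * q x)) \<le> cmod I1 + \<bar>d\<bar> * cmod I2" .
  have "cmod (I1 - cnj (a 0) * r) \<le> 4 * eps * cmod (a 0) * integral {0..1} (\<lambda>x. cmod (Q x * q x))"
    using norm_integral_mult_wave_le[OF e Qq] by (simp add: I1_def r_def integral_Q_q)
  also have "\<dots> \<le> 4 * eps * cmod (a 0) * (K * K)"
    by (rule mult_left_mono[OF integral_mult_q_le[OF cQ Q_S_bounded(1)]]) (use eps_nonneg in auto)
  finally have I1_le: "cmod I1 \<le> 4 * eps * cmod (a 0) * (K * K) + cmod (a 0) * cmod r"
    using norm_triangle_sub[of I1 "cnj (a 0) * r"] by (simp add: norm_mult)
  have "cmod I2 \<le> 4 * cmod (a 0) * integral {0..1} (\<lambda>x. cmod (Q x))"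
    unfolding I2_def
  proof (rule norm_integral_mult_le[OF continuous_wave_cis])
    show "Q absolutely_integrable_on {0..1}" by (rule absolutely_integrable_continuous_real[OF cQ])
    fix x :: real assume x: "x \<in> {0..1}"
    show "cmod (of_real (\<Phi> x) * cis (- w * x)) \<le> 4 * cmod (a 0)"
      using cmod_wave_le[OF x] amplitude_almost_constant(1)[OF e x] by linarith
  qed
  also have "\<dots> \<le> 4 * cmod (a 0) * K"
  proof (rule mult_left_mono)
    have "integral {0..1} (\<lambda>x. cmod (Q x)) \<le> integral {0..1::real} (\<lambda>x. K)"
      by (rule integral_le) (use Q_S_bounded cQ in \<open>auto intro!: integrable_continuous_interval continuous_intros\<close>)
    then show "integral {0..1} (\<lambda>x. cmod (Q x)) \<le> K" by simp
  qed simp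
  finally have "\<bar>d\<bar> * cmod I2 \<le> \<bar>d\<bar> * (4 * cmod (a 0) * K)" by (rule mult_left_mono) simp
  with total I1_le have "2 * w * cmod (integral {0..1} (\<lambda>x. a x * q x))
      \<le> 4 * eps * cmod (a 0) * (K * K) + cmod (a 0) * cmod r + \<bar>d\<bar> * (4 * cmod (a 0) * K)"
    by linarith
  also have "\<dots> = cmod (a 0) * (4 * K\<^sup>2 * eps + cmod r + 4 * K * \<bar>d\<bar>)"
    by (simp add: power2_eq_square distrib_left mult_ac)
  finally show ?thesis by (simp only: r_def)
qed

text \<open>
  The same integration by parts with \<open>S\<close> in place of \<open>Q\<close>. Here \<open>S\<close> itself tends to zero with
  growing frequency, so its modulus may be taken inside the integral.
\<close>
lemma antiresonant_term_le:
  assumes e: "eps \<le> 1/2"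
  shows "2 * w * cmod (integral {0..1} (\<lambda>x. cnj (a x - a 0) * (q x * cis (- (2 * w) * x))))
    \<le> 4 * cmod (a 0) * (integral {0..1} (\<lambda>x. cmod (S x) * cmod (q x)) + K * \<bar>d\<bar>)"
proof -
  note cS = abs_cont_deriv_continuous[OF S_deriv]
  define b where "b = (\<lambda>x. (q x - of_real d) * (of_real (\<Phi> x) * cis (- w * x)) / (2 * \<i> * of_real w))"
  have "abs_cont_deriv (\<lambda>x. a x - a 0) b"
  proof -
    have "abs_cont_deriv (\<lambda>x. - a 0) (\<lambda>x. 0)" by (simp add: abs_cont_deriv_def)
    from abs_cont_deriv_add[OF deriv this] show ?thesis by (simp add: b_def)
  qed
  then have db: "abs_cont_deriv (\<lambda>x. cnj (a x - a 0)) (\<lambda>x. cnj (b x))"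
    by (rule abs_cont_deriv_linear[OF bounded_linear_cnj])
  have qd: "(\<lambda>x. cnj (q x - of_real d)) absolutely_integrable_on {0..1}"
    using absolutely_integrable_linear[OF q_minus_d bounded_linear_cnj] by (simp add: o_def)
  have Sqd: "(\<lambda>x. S x * cnj (q x - of_real d)) absolutely_integrable_on {0..1}"
    by (rule absolutely_integrable_continuous_mult[OF cS qd])
  have "integral {0..1} (\<lambda>x. cnj (a x - a 0) * (q x * cis (- (2 * w) * x)))
      = - integral {0..1} (\<lambda>x. S x * cnj (b x))"
    by (rule integral_by_parts_abs_cont[OF db S_deriv]) (simp add: Q_ends closed)
  also have "\<dots> = - integral {0..1} (\<lambda>x. cnj (of_real (\<Phi> x) * cis (- w * x) / (2 * \<i> * of_real w)) * (S x * cnj (q x - of_real d)))"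
    by (simp add: b_def mult_ac)
  also have "cmod \<dots> \<le> 2 * cmod (a 0) / w * integral {0..1} (\<lambda>x. cmod (S x * cnj (q x - of_real d)))"
    unfolding norm_minus_cancel
  proof (rule norm_integral_mult_le[OF _ Sqd])
    show "continuous_on {0..1} (\<lambda>x. cnj (of_real (\<Phi> x) * cis (- w * x) / (2 * \<i> * of_real w)))"
      using w_pos by (intro continuous_intros continuous_wave_cis) auto
    fix x :: real assume x: "x \<in> {0..1}"
    have "cmod (of_real (\<Phi> x) * cis (- w * x)) \<le> 4 * cmod (a 0)"
      using cmod_wave_le[OF x] amplitude_almost_constant(1)[OF e x] by linarith
    then show "cmod (cnj (of_real (\<Phi> x) * cis (- w * x) / (2 * \<i> * of_real w))) \<le> 2 * cmod (a 0) / w"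
      unfolding complex_mod_cnj using w_pos by (simp add: norm_divide norm_mult field_simps)
  qed
  finally have bound: "cmod (integral {0..1} (\<lambda>x. cnj (a x - a 0) * (q x * cis (- (2 * w) * x))))
      \<le> 2 * cmod (a 0) / w * integral {0..1} (\<lambda>x. cmod (S x * cnj (q x - of_real d)))" .
  have "integral {0..1} (\<lambda>x. cmod (S x * cnj (q x - of_real d)))
      \<le> integral {0..1} (\<lambda>x. cmod (S x) * cmod (q x) + K * \<bar>d\<bar>)"
  proof (rule integral_le)
    show "(\<lambda>x. cmod (S x * cnj (q x - of_real d))) integrable_on {0..1}"
      using Sqd by (simp add: absolutely_integrable_on_def)
    show "(\<lambda>x. cmod (S x) * cmod (q x) + K * \<bar>d\<bar>) integrable_on {0..1}"
      using absolutely_integrable_continuous_mult[OF cS q]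
      by (intro integrable_add) (auto simp: absolutely_integrable_on_def norm_mult)
    fix x :: real assume x: "x \<in> {0..1}"
    have "cmod (S x) * cmod (q x - of_real d) \<le> cmod (S x) * (cmod (q x) + \<bar>d\<bar>)"
      using norm_triangle_ineq4[of "q x" "of_real d"] by (intro mult_left_mono) auto
    also have "\<dots> \<le> cmod (S x) * cmod (q x) + K * \<bar>d\<bar>"
      using Q_S_bounded(2)[OF x] by (simp add: distrib_left mult_right_mono)
    finally show "cmod (S x * cnj (q x - of_real d)) \<le> cmod (S x) * cmod (q x) + K * \<bar>d\<bar>"
      unfolding norm_mult complex_mod_cnj .
  qed
  also have "\<dots> = integral {0..1} (\<lambda>x. cmod (S x) * cmod (q x)) + K * \<bar>d\<bar>"
  proof -
    have "(\<lambda>x. cmod (S x) * cmod (q x)) integrable_on {0..1}"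
      using absolutely_integrable_continuous_mult[OF cS q] by (simp add: absolutely_integrable_on_def norm_mult)
    from integral_add[OF this integrable_const_ivl[of "K * \<bar>d\<bar>" 0 1]] show ?thesis by simp
  qed
  finally have "2 * cmod (a 0) / w * integral {0..1} (\<lambda>x. cmod (S x * cnj (q x - of_real d)))
      \<le> 2 * cmod (a 0) / w * (integral {0..1} (\<lambda>x. cmod (S x) * cmod (q x)) + K * \<bar>d\<bar>)"
    by (rule mult_left_mono) (use w_pos in simp)
  with bound have "2 * w * cmod (integral {0..1} (\<lambda>x. cnj (a x - a 0) * (q x * cis (- (2 * w) * x))))
      \<le> 2 * w * (2 * cmod (a 0) / w * (integral {0..1} (\<lambda>x. cmod (S x) * cmod (q x)) + K * \<bar>d\<bar>))"
    by (intro mult_left_mono) (use w_pos in auto)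
  then show ?thesis using w_pos by simp
qed

text \<open>
  Besides the two integrals just estimated, the remainder contains the error of replacing \<open>a 0\<close> by \<open>v\<close>
  in the main term; that error is \<open>O(1/w)\<close> and is multiplied by the resonant coefficient.
\<close>
theorem remainder_le:
  assumes e: "eps \<le> 1/2"
  shows "2 * w * cmod (of_real d * v - qhat * cnj v)
    \<le> cmod (a 0) * (4 * K\<^sup>2 * eps + cmod (integral {0..1} (\<lambda>x. Q x * q x * cis (- (2 * w) * x)))
        + 8 * K * \<bar>d\<bar> + 4 * integral {0..1} (\<lambda>x. cmod (S x) * cmod (q x)) + 8 * cmod qhat * (K + \<bar>d\<bar>))"
proof -
  define T1 where "T1 = integral {0..1} (\<lambda>x. a x * q x)"
  define T2 where "T2 = integral {0..1} (\<lambda>x. cnj (a x - a 0) * (q x * cis (- (2 * w) * x)))"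
  have iq: "q integrable_on {0..1}" using q set_lebesgue_integral_eq_integral(1) by blast
  have "T1 = integral {0..1} (\<lambda>x. (a x - a 0) * q x + a 0 * q x)"
    unfolding T1_def by (intro Henstock_Kurzweil_Integration.integral_cong) (simp add: left_diff_distrib)
  also have "\<dots> = integral {0..1} (\<lambda>x. (a x - a 0) * q x) + integral {0..1} (\<lambda>x. a 0 * q x)"
    by (intro integral_add integrable_continuous_mult_L1 q continuous_intros continuous_a)
  finally have T1: "integral {0..1} (\<lambda>x. (a x - a 0) * q x) = T1" by (simp add: mean_zero)
  have decomp: "of_real d * v - qhat * cnj v = T1 + T2 + qhat * cnj (a 0 - v)"
  proof -
    have "of_real d * v = a 0 * 0 + cnj (a 0) * qhat + T1 + T2"
      unfolding frequency_shift_eq integral_mult_wave[OF q] T1 mean_zero T2_def resonant_coeff_def by (rule refl)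
    then show ?thesis by (simp add: right_diff_distrib mult.commute)
  qed
  have "cmod (of_real d * v - qhat * cnj v) \<le> cmod T1 + cmod T2 + cmod (qhat * cnj (a 0 - v))"
    unfolding decomp
    using norm_triangle_ineq[of "T1 + T2" "qhat * cnj (a 0 - v)"] norm_triangle_ineq[of T1 T2] by linarith
  also have "cmod (qhat * cnj (a 0 - v)) \<le> cmod qhat * (4 * eps * cmod (a 0))"
    using v_close[OF e] unfolding norm_mult complex_mod_cnj by (intro mult_left_mono) (auto simp: norm_minus_commute)
  finally have "2 * w * cmod (of_real d * v - qhat * cnj v)
      \<le> 2 * w * (cmod T1 + cmod T2 + cmod qhat * (4 * eps * cmod (a 0)))"
    using w_pos by (intro mult_left_mono) auto
  also have "\<dots> = 2 * w * cmod T1 + 2 * w * cmod T2 + 8 * cmod qhat * (w * eps) * cmod (a 0)"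
    by (simp add: algebra_simps)
  also have "w * eps = K + \<bar>d\<bar>" using w_pos by (simp add: wave_defect_def)
  finally show ?thesis
    using resonant_term_le[OF e] antiresonant_term_le[OF e]
    by (simp add: T1_def T2_def algebra_simps)
qed

end

section \<open>Asymptotics of normalized standing waves\<close>

text \<open>
  Since \<open>\<Phi>2\<close> is real, \<open>\<Phi>1 \<Phi>2\<close> is twice the real part of \<open>\<Phi>1 e\<^bsup>- i w x\<^esup> cnj (a2 x)\<close>; freezing \<open>a2\<close> at \<open>0\<close>
  leaves the coefficient of the first wave as the integral. The constant is \<open>40 = 2 (8 + 12)\<close>, with \<open>8\<close>
  from freezing \<open>a2\<close> and \<open>12\<close> from replacing \<open>a2 0\<close> by the coefficient of the second wave. It applies
  to two eigenfunctions of one pair as well as to an eigenfunction paired with itself.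
\<close>
lemma standing_wave_inner_product:
  assumes w1: "standing_wave q \<Phi>1 a1 w d1 k" and w2: "standing_wave q \<Phi>2 a2 w d2 k"
    and e1: "wave_defect q w d1 \<le> 1/2" and e2: "wave_defect q w d2 \<le> 1/2"
  shows "\<bar>integral {0..1} (\<lambda>x. \<Phi>1 x * \<Phi>2 x) - 2 * Re (wave_coeff \<Phi>1 w * cnj (wave_coeff \<Phi>2 w))\<bar>
    \<le> 40 * wave_defect q w d2 * (cmod (a1 0) * cmod (a2 0))"
proof -
  interpret W1: standing_wave q \<Phi>1 a1 w d1 k by (rule w1)
  interpret W2: standing_wave q \<Phi>2 a2 w d2 k by (rule w2)
  define u where "u = (\<lambda>x. of_real (\<Phi>1 x) * cis (- w * x))"
  have cu: "continuous_on {0..1} u" unfolding u_def by (rule W1.continuous_wave_cis)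
  define I where "I = integral {0..1} (\<lambda>x. u x * cnj (a2 x))"
  have u_le: "cmod (u x) \<le> 4 * cmod (a1 0)" if "x \<in> {0..1}" for x
    using W1.cmod_wave_le[OF that] W1.amplitude_almost_constant(1)[OF e1 that] by (simp add: u_def)
  have i: "(\<lambda>x. u x * cnj (a2 x)) integrable_on {0..1}" "(\<lambda>x. u x * cnj (a2 0)) integrable_on {0..1}"
    by (intro integrable_continuous_interval continuous_intros cu W2.continuous_a)+
  have "integral {0..1} (\<lambda>x. \<Phi>1 x * \<Phi>2 x) = integral {0..1} (\<lambda>x. Re (2 * (u x * cnj (a2 x))))"
  proof (rule Henstock_Kurzweil_Integration.integral_cong)
    fix x :: real assume x: "x \<in> {0..1}"
    have "complex_of_real (\<Phi>1 x * \<Phi>2 x) = of_real (\<Phi>1 x) * cis (w * x) * a2 x + u x * cnj (a2 x)"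
      by (simp add: u_def W2.wave[OF x] algebra_simps)
    also have "of_real (\<Phi>1 x) * cis (w * x) * a2 x = cnj (u x * cnj (a2 x))"
      by (simp add: u_def cis_cnj)
    finally have "Re (complex_of_real (\<Phi>1 x * \<Phi>2 x)) = Re (cnj (u x * cnj (a2 x)) + u x * cnj (a2 x))"
      by (rule arg_cong)
    then show "\<Phi>1 x * \<Phi>2 x = Re (2 * (u x * cnj (a2 x)))" by simp
  qed
  also have "\<dots> = Re (2 * I)"
  proof -
    have "(\<lambda>x. 2 * (u x * cnj (a2 x))) integrable_on {0..1}" using i(1) by (rule integrable_on_mult_right)
    from integral_linear[OF this bounded_linear_Re] show ?thesis by (simp add: o_def I_def)
  qed
  finally have "integral {0..1} (\<lambda>x. \<Phi>1 x * \<Phi>2 x) - 2 * Re (W1.v * cnj W2.v) = 2 * Re (I - W1.v * cnj W2.v)"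
    by simp
  moreover have "\<bar>Re (I - W1.v * cnj W2.v)\<bar> \<le> cmod (I - W1.v * cnj W2.v)" by (rule abs_Re_le_cmod)
  moreover have "cmod (I - W1.v * cnj W2.v) \<le> cmod (I - W1.v * cnj (a2 0)) + cmod (W1.v * cnj (a2 0 - W2.v))"
    using norm_triangle_ineq[of "I - W1.v * cnj (a2 0)" "W1.v * cnj (a2 0 - W2.v)"] by (simp add: algebra_simps)
  moreover have "cmod (I - W1.v * cnj (a2 0)) \<le> 8 * W2.eps * (cmod (a1 0) * cmod (a2 0))"
  proof -
    have "I - W1.v * cnj (a2 0) = integral {0..1} (\<lambda>x. u x * cnj (a2 x) - u x * cnj (a2 0))"
      using integral_diff[OF i] by (simp add: I_def wave_coeff_def u_def)
    also have "cmod \<dots> \<le> integral {0..1::real} (\<lambda>x. 4 * cmod (a1 0) * (2 * W2.eps * cmod (a2 0)))"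
    proof (rule integral_norm_bound_integral)
      show "(\<lambda>x. u x * cnj (a2 x) - u x * cnj (a2 0)) integrable_on {0..1}"
        by (rule integrable_diff[OF i])
      fix x :: real assume x: "x \<in> {0..1}"
      have "cmod (u x * cnj (a2 x) - u x * cnj (a2 0)) = cmod (u x) * cmod (a2 x - a2 0)"
        by (metis complex_cnj_diff complex_mod_cnj norm_mult right_diff_distrib)
      also have "\<dots> \<le> 4 * cmod (a1 0) * (2 * W2.eps * cmod (a2 0))"
        by (rule mult_mono[OF u_le[OF x] W2.amplitude_almost_constant(2)[OF e2 x]]) auto
      finally show "cmod (u x * cnj (a2 x) - u x * cnj (a2 0)) \<le> 4 * cmod (a1 0) * (2 * W2.eps * cmod (a2 0))" .
    qed auto
    finally show ?thesis by (simp add: mult_ac)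
  qed
  moreover have "cmod (W1.v * cnj (a2 0 - W2.v)) \<le> 12 * W2.eps * (cmod (a1 0) * cmod (a2 0))"
  proof -
    have "W1.eps * cmod (a1 0) \<le> 1/2 * cmod (a1 0)" by (rule mult_right_mono[OF e1]) simp
    then have "cmod W1.v \<le> 3 * cmod (a1 0)"
      using W1.v_close[OF e1] norm_triangle_sub[of W1.v "a1 0"] by linarith
    moreover have "cmod (a2 0 - W2.v) \<le> 4 * W2.eps * cmod (a2 0)"
      using W2.v_close[OF e2] by (simp add: norm_minus_commute)
    ultimately have "cmod W1.v * cmod (a2 0 - W2.v) \<le> 3 * cmod (a1 0) * (4 * W2.eps * cmod (a2 0))"
      by (intro mult_mono) auto
    then show ?thesis unfolding norm_mult complex_mod_cnj by (simp add: mult_ac)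
  qed
  ultimately show ?thesis by (simp only: abs_mult)
qed

text \<open>
  The inner product of the wave with itself gives \<open>\<bar>1 - 2 \<bar>v\<bar>\<^sup>2\<bar> \<le> 40 eps \<bar>a 0\<bar>\<^sup>2\<close>, and \<open>\<bar>a 0\<bar> \<le> 2 \<bar>v\<bar>\<close>; with
  \<open>160 eps \<le> 1\<close> the right-hand side is at most \<open>\<bar>v\<bar>\<^sup>2\<close>, which bounds \<open>v\<close>.
\<close>
lemma (in standing_wave) normalized_bounds:
  assumes e: "eps \<le> 1/160" and norm: "integral {0..1} (\<lambda>x. (\<Phi> x)\<^sup>2) = 1"
  shows "\<bar>1 - 2 * (cmod v)\<^sup>2\<bar> \<le> 160 * eps" "cmod (a 0) \<le> 2"
proof -
  have e2: "eps \<le> 1/2" using e by simp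
  have "eps * cmod (a 0) \<le> 1/160 * cmod (a 0)" by (rule mult_right_mono[OF e]) simp
  then have a: "cmod (a 0) \<le> 2 * cmod v"
    using v_close[OF e2, unfolded mult.assoc] norm_triangle_sub[of "a 0" v] norm_minus_commute[of "a 0" v]
      norm_ge_zero[of v] by linarith
  have "cmod (a 0) * cmod (a 0) \<le> (2 * cmod v) * (2 * cmod v)"
    by (rule mult_mono[OF a a]) auto
  then have "40 * eps * (cmod (a 0) * cmod (a 0)) \<le> 40 * eps * ((2 * cmod v) * (2 * cmod v))"
    by (rule mult_left_mono) (use eps_nonneg in simp)
  also have "\<dots> = 160 * eps * (cmod v)\<^sup>2" by (simp add: power2_eq_square)
  finally have "40 * eps * (cmod (a 0) * cmod (a 0)) \<le> 160 * eps * (cmod v)\<^sup>2" .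
  moreover have "v * cnj v = of_real ((cmod v)\<^sup>2)" by (rule complex_norm_square[symmetric])
  then have "\<bar>1 - 2 * (cmod v)\<^sup>2\<bar> \<le> 40 * eps * (cmod (a 0) * cmod (a 0))"
    using standing_wave_inner_product[OF standing_wave_axioms standing_wave_axioms e2 e2] norm
    by (simp add: power2_eq_square)
  ultimately have *: "\<bar>1 - 2 * (cmod v)\<^sup>2\<bar> \<le> 160 * eps * (cmod v)\<^sup>2" by linarith
  moreover have "160 * eps * (cmod v)\<^sup>2 \<le> 1 * (cmod v)\<^sup>2"
    by (rule mult_right_mono) (use e in auto)
  ultimately have v: "(cmod v)\<^sup>2 \<le> 1" by linarith
  then have "cmod v \<le> 1" by (simp add: abs_square_le_1)
  with a show "cmod (a 0) \<le> 2" by simp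
  have "160 * eps * (cmod v)\<^sup>2 \<le> 160 * eps * 1"
    by (rule mult_left_mono[OF v]) (use eps_nonneg in simp)
  with * show "\<bar>1 - 2 * (cmod v)\<^sup>2\<bar> \<le> 160 * eps" by linarith
qed

lemma riemann_lebesgue_odd:
  fixes f :: "real \<Rightarrow> complex"
  assumes "f absolutely_integrable_on {0..1}" "0 \<le> x" "x \<le> 1"
  shows "(\<lambda>n. integral {0..x} (\<lambda>t. f t * cis (- (2 * (pi * real (2 * n + 1))) * t))) \<longlonglongrightarrow> 0"
proof -
  have "strict_mono (\<lambda>n::nat. 2 * n + 1)" by (rule strict_monoI) simp
  from LIMSEQ_subseq_LIMSEQ[OF riemann_lebesgue[OF assms] this] show ?thesis
    by (simp add: o_def mult.assoc)
qed

text \<open>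
  The a priori bound on \<open>d\<close> makes \<open>eps\<close> tend to zero. Then \<open>frequency_shift_le\<close> improves the
  bound to \<open>d \<longrightarrow> 0\<close>, and with that every term of \<open>remainder_le\<close> tends to zero.
\<close>
lemma standing_wave_asymptotics:
  fixes q :: "real \<Rightarrow> complex" and \<Phi> :: "nat \<Rightarrow> real \<Rightarrow> real" and a :: "nat \<Rightarrow> real \<Rightarrow> complex"
    and d w :: "nat \<Rightarrow> real"
  defines "w \<equiv> \<lambda>n. pi * real (2 * n + 1)"
  defines "v \<equiv> \<lambda>n. wave_coeff (\<Phi> n) (w n)" and "qhat \<equiv> \<lambda>n. resonant_coeff q (w n)"
  assumes wave: "\<forall>\<^sub>F n in sequentially. mean_zero_standing_wave q (\<Phi> n) (a n) (w n) (d n) (2 * n + 1)"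
    and norm: "\<forall>\<^sub>F n in sequentially. integral {0..1} (\<lambda>x. (\<Phi> n x)\<^sup>2) = 1"
    and d: "d \<in> O(\<lambda>n. sqrt (real n))"
  shows "(\<lambda>n. wave_defect q (w n) (d n)) \<longlonglongrightarrow> 0"
    and "\<forall>\<^sub>F n in sequentially. cmod (a n 0) \<le> 2"
    and "(\<lambda>n. (cmod (v n))\<^sup>2) \<longlonglongrightarrow> 1/2"
    and "d \<longlonglongrightarrow> 0"
    and "(\<lambda>n. w n * cmod (of_real (d n) * v n - qhat n * cnj (v n))) \<longlonglongrightarrow> 0"
proof -
  define eps where "eps = (\<lambda>n. wave_defect q (w n) (d n))"
  obtain n0 where "mean_zero_standing_wave q (\<Phi> n0) (a n0) (w n0) (d n0) (2 * n0 + 1)"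
    using wave by (auto simp: eventually_sequentially)
  then interpret W0: mean_zero_standing_wave q "\<Phi> n0" "a n0" "w n0" "d n0" "2 * n0 + 1" .
  define K where "K = l1_norm q"
  define s where "s = (\<lambda>n. integral {0..1} (\<lambda>x. cmod (modulated_primitive q (w n) x) * cmod (q x)))"
  define r where "r = (\<lambda>n. integral {0..1} (\<lambda>x. primitive q x * q x * cis (- (2 * w n) * x)))"
  have wn: "w n > 0" for n by (simp add: w_def)
  have K: "K \<ge> 0" unfolding K_def by (rule W0.K_nonneg)
  have qhat: "qhat \<longlonglongrightarrow> 0"
    using riemann_lebesgue_odd[OF W0.q zero_le_one order_refl] by (simp only: qhat_def resonant_coeff_def w_def)
  have r: "r \<longlonglongrightarrow> 0"
    unfolding r_def w_def
    by (rule riemann_lebesgue_odd[OF absolutely_integrable_continuous_mult[OF abs_cont_deriv_continuous[OF W0.Q_deriv] W0.q]]) auto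
  \<comment> \<open>The zero function is a standing wave of every frequency, which makes the facts on
    \<open>modulated_primitive\<close> available for all \<open>n\<close>.\<close>
  have S_wave: "mean_zero_standing_wave q (\<lambda>x. 0) (\<lambda>x. 0) (w n) 0 (2 * n + 1)" for n
    by unfold_locales (auto simp: w_def abs_cont_deriv_def W0.q W0.mean_zero)
  have s: "s \<longlonglongrightarrow> 0"
  proof -
    have "s \<longlonglongrightarrow> integral {0..1::real} (\<lambda>x. 0 :: real)"
      unfolding s_def
    proof (rule dominated_convergence(2)[where h = "\<lambda>x. K * cmod (q x)"])
      have "(\<lambda>x. cmod (q x)) integrable_on {0..1}" using W0.q by (simp add: absolutely_integrable_on_def)
      then show "(\<lambda>x. K * cmod (q x)) integrable_on {0..1}" by (rule integrable_on_mult_right)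
      fix n
      interpret Wn: mean_zero_standing_wave q "\<lambda>x. 0" "\<lambda>x. 0" "w n" 0 "2 * n + 1" by (rule S_wave)
      show "(\<lambda>x. cmod (modulated_primitive q (w n) x) * cmod (q x)) integrable_on {0..1}"
        using absolutely_integrable_continuous_mult[OF abs_cont_deriv_continuous[OF Wn.S_deriv] W0.q]
        by (simp add: absolutely_integrable_on_def norm_mult)
      fix x :: real assume "x \<in> {0..1}"
      then show "norm (cmod (modulated_primitive q (w n) x) * cmod (q x)) \<le> K * cmod (q x)"
        using Wn.Q_S_bounded(2)[of x] by (simp add: K_def mult_right_mono)
    next
      fix x :: real assume "x \<in> {0..1}"
      then have "(\<lambda>n. modulated_primitive q (w n) x) \<longlonglongrightarrow> 0"
        unfolding modulated_primitive_def w_def using riemann_lebesgue_odd[OF W0.q, of x] by simp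
      from tendsto_mult_left_zero[OF tendsto_norm_zero[OF this]]
      show "(\<lambda>n. cmod (modulated_primitive q (w n) x) * cmod (q x)) \<longlonglongrightarrow> 0" .
    qed
    then show ?thesis by simp
  qed
  have eps_eq: "eps n = (K + \<bar>d n\<bar>) / w n" for n by (simp add: eps_def wave_defect_def K_def)
  show eps: "eps \<longlonglongrightarrow> 0"
  proof -
    obtain C where C: "\<forall>\<^sub>F n in sequentially. norm (d n) \<le> C * norm (sqrt (real n))"
      using landau_o.bigE[OF d] by blast
    have "(\<lambda>n. (K + C * sqrt (real n)) / (pi * real (2 * n + 1))) \<longlonglongrightarrow> 0" by real_asymp
    then show ?thesis
    proof (rule Lim_null_comparison[rotated])
      show "\<forall>\<^sub>F n in sequentially. norm (eps n) \<le> (K + C * sqrt (real n)) / (pi * real (2 * n + 1))"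
        using C
      proof eventually_elim
        case (elim n)
        then have "(K + \<bar>d n\<bar>) / w n \<le> (K + C * sqrt (real n)) / w n"
          using wn[of n] by (intro divide_right_mono) auto
        moreover have "norm (eps n) = (K + \<bar>d n\<bar>) / w n"
          using K wn[of n] by (simp add: eps_eq)
        ultimately show ?case by (simp add: w_def)
      qed
    qed
  qed
  have eps_small: "\<forall>\<^sub>F n in sequentially. eps n < 1/160"
    using order_tendstoD(2)[OF eps, of "1/160"] by simp
  have bounds: "\<forall>\<^sub>F n in sequentially. \<bar>1 - 2 * (cmod (v n))\<^sup>2\<bar> \<le> 160 * eps n \<and> cmod (a n 0) \<le> 2"
    using eps_small wave norm
  proof eventually_elim
    case (elim n)
    then interpret W: mean_zero_standing_wave q "\<Phi> n" "a n" "w n" "d n" "2 * n + 1" by simp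
    show ?case
      using W.normalized_bounds elim by (simp add: eps_def v_def)
  qed
  then show a: "\<forall>\<^sub>F n in sequentially. cmod (a n 0) \<le> 2" by (rule eventually_mono) simp
  show v: "(\<lambda>n. (cmod (v n))\<^sup>2) \<longlonglongrightarrow> 1/2"
  proof -
    have "(\<lambda>n. 160 * eps n) \<longlonglongrightarrow> 0" using tendsto_mult_right_zero[OF eps] .
    then have "(\<lambda>n. 1 - 2 * (cmod (v n))\<^sup>2) \<longlonglongrightarrow> 0"
      by (rule Lim_null_comparison[rotated]) (use bounds in \<open>auto elim!: eventually_mono\<close>)
    then have "(\<lambda>n. (1 - (1 - 2 * (cmod (v n))\<^sup>2)) / 2) \<longlonglongrightarrow> (1 - 0) / 2" by (intro tendsto_intros) auto
    then show ?thesis by simp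
  qed
  have v_half: "\<forall>\<^sub>F n in sequentially. cmod (v n) \<ge> 1/2"
  proof -
    have "\<forall>\<^sub>F n in sequentially. (cmod (v n))\<^sup>2 > 1/4" using order_tendstoD(1)[OF v, of "1/4"] by simp
    then show ?thesis
    proof (rule eventually_mono)
      fix n assume "(cmod (v n))\<^sup>2 > 1/4"
      then have "(1/2)\<^sup>2 \<le> (cmod (v n))\<^sup>2" by (simp add: power2_eq_square)
      then show "cmod (v n) \<ge> 1/2" by (rule power2_le_imp_le) simp
    qed
  qed
  show d0: "d \<longlonglongrightarrow> 0"
  proof -
    have "(\<lambda>n. 4 * (4 * eps n * K + cmod (qhat n))) \<longlonglongrightarrow> 4 * (4 * 0 * K + 0)"
      by (intro tendsto_intros eps tendsto_norm_zero qhat)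
    then have "(\<lambda>n. 4 * (4 * eps n * K + cmod (qhat n))) \<longlonglongrightarrow> 0" by simp
    then show ?thesis
    proof (rule Lim_null_comparison[rotated])
      show "\<forall>\<^sub>F n in sequentially. norm (d n) \<le> 4 * (4 * eps n * K + cmod (qhat n))"
        using eps_small wave a v_half
      proof eventually_elim
        case (elim n)
        then interpret W: mean_zero_standing_wave q "\<Phi> n" "a n" "w n" "d n" "2 * n + 1" by simp
        have "\<bar>d n\<bar> * (1/2) \<le> \<bar>d n\<bar> * cmod (v n)" by (rule mult_left_mono) (use elim in auto)
        also have "\<dots> \<le> (4 * eps n * K + cmod (qhat n)) * cmod (a n 0)"
          using W.frequency_shift_le elim(1) by (simp add: eps_def v_def qhat_def K_def)
        also have "\<dots> \<le> (4 * eps n * K + cmod (qhat n)) * 2"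
          using W.eps_nonneg K elim by (intro mult_left_mono) (auto simp: eps_def)
        finally show ?case by simp
      qed
    qed
  qed
  show "(\<lambda>n. w n * cmod (of_real (d n) * v n - qhat n * cnj (v n))) \<longlonglongrightarrow> 0"
  proof -
    define b where "b = (\<lambda>n. 4 * K\<^sup>2 * eps n + cmod (r n) + 8 * K * \<bar>d n\<bar> + 4 * s n + 8 * cmod (qhat n) * (K + \<bar>d n\<bar>))"
    have "b \<longlonglongrightarrow> 4 * K\<^sup>2 * 0 + 0 + 8 * K * 0 + 4 * 0 + 8 * 0 * (K + 0)"
      unfolding b_def by (intro tendsto_intros eps tendsto_norm_zero qhat r s tendsto_rabs_zero d0)
    then have "b \<longlonglongrightarrow> 0" by simp
    then show ?thesis
    proof (rule Lim_null_comparison[rotated])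
      show "\<forall>\<^sub>F n in sequentially. norm (w n * cmod (of_real (d n) * v n - qhat n * cnj (v n))) \<le> b n"
        using eps_small wave a
      proof eventually_elim
        case (elim n)
        then interpret W: mean_zero_standing_wave q "\<Phi> n" "a n" "w n" "d n" "2 * n + 1" by simp
        have "2 * w n * cmod (of_real (d n) * v n - qhat n * cnj (v n)) \<le> cmod (a n 0) * b n"
          using W.remainder_le elim(1) by (simp add: eps_def v_def qhat_def K_def b_def r_def s_def)
        moreover have "b n \<ge> 0"
        proof -
          have "s n \<ge> 0" unfolding s_def
            by (rule integral_nonneg)
               (use absolutely_integrable_continuous_mult[OF abs_cont_deriv_continuous[OF W.S_deriv] W.q]
                 in \<open>auto simp: absolutely_integrable_on_def norm_mult\<close>)
          then show ?thesis using W.eps_nonneg K by (auto simp: b_def eps_def)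
        qed
        then have "cmod (a n 0) * b n \<le> 2 * b n" using elim by (intro mult_right_mono) auto
        ultimately show ?case using wn[of n] by simp
      qed
    qed
  qed
qed

section \<open>Signs and separation of the eigenvalues\<close>

text \<open>
  With \<open>c = \<bar>c\<bar> u\<^sup>2\<close>, rotation by \<open>cnj u\<close> turns \<open>d v - c cnj v\<close> into \<open>d z - \<bar>c\<bar> cnj z\<close> for \<open>z = v cnj u\<close>, whose
  imaginary part is \<open>(d + \<bar>c\<bar>) Im z\<close>. Two orthogonal vectors of squared length \<open>1/2\<close> have imaginary parts
  whose squares sum to \<open>1/2\<close>, so the moduli sum to at least \<open>1 / sqrt 2 > 1/2\<close>; the slack absorbs the
  tolerances \<open>1/20\<close>.
\<close>
lemma same_sign_remainder_large:
  fixes c v1 v2 :: complex and d1 d2 :: real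
  assumes c: "c \<noteq> 0" and d: "d1 \<ge> 0" "d2 \<ge> 0"
    and v: "\<bar>(cmod v1)\<^sup>2 - 1/2\<bar> \<le> 1/20" "\<bar>(cmod v2)\<^sup>2 - 1/2\<bar> \<le> 1/20" "\<bar>Re (v1 * cnj v2)\<bar> \<le> 1/20"
  shows "cmod c / 2 < cmod (of_real d1 * v1 - c * cnj v1) + cmod (of_real d2 * v2 - c * cnj v2)"
proof -
  define u where "u = csqrt (c / of_real (cmod c))"
  have u2: "u * u = c / of_real (cmod c)" unfolding u_def by (metis power2_csqrt power2_eq_square)
  have "(cmod u)\<^sup>2 = 1" using u2 c by (metis divide_self norm_divide norm_mult norm_of_real abs_norm_cancel norm_eq_zero power2_eq_square)
  then have u1: "cmod u = 1" by (simp add: power2_eq_1_iff) (metis norm_ge_zero zero_le_one neg_0_le_iff_le not_one_le_zero)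
  have uu: "u * cnj u = 1" using u1 by (simp add: complex_norm_square[symmetric])
  have cu: "c = of_real (cmod c) * (u * u)" using u2 c by simp
  have large: "cmod c * \<bar>Im (v * cnj u)\<bar> \<le> cmod (of_real e * v - c * cnj v)" if "e \<ge> 0" for e v
  proof -
    have "cnj u * (of_real e * v - c * cnj v) = of_real e * (v * cnj u) - of_real (cmod c) * ((u * cnj u) * (u * cnj v))"
      by (subst (1) cu) (simp add: algebra_simps)
    also have "\<dots> = of_real e * (v * cnj u) - of_real (cmod c) * cnj (v * cnj u)"
      by (simp add: uu mult.commute)
    finally have eq: "cnj u * (of_real e * v - c * cnj v) = of_real e * (v * cnj u) - of_real (cmod c) * cnj (v * cnj u)" .
    have "cmod c * \<bar>Im (v * cnj u)\<bar> \<le> (e + cmod c) * \<bar>Im (v * cnj u)\<bar>"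
      using that by (intro mult_right_mono) auto
    also have "\<dots> = \<bar>(e + cmod c) * Im (v * cnj u)\<bar>" using that by (simp add: abs_mult)
    also have "(e + cmod c) * Im (v * cnj u) = Im (cnj u * (of_real e * v - c * cnj v))"
      unfolding eq by (simp add: algebra_simps)
    also have "\<bar>\<dots>\<bar> \<le> cmod (cnj u * (of_real e * v - c * cnj v))" by (rule abs_Im_le_cmod)
    also have "\<dots> = cmod (of_real e * v - c * cnj v)" by (simp add: norm_mult u1)
    finally show ?thesis .
  qed
  define x1 y1 x2 y2 where "x1 = Re (v1 * cnj u)" "y1 = Im (v1 * cnj u)" "x2 = Re (v2 * cnj u)" "y2 = Im (v2 * cnj u)"
  note xy = this
  have n: "x1\<^sup>2 + y1\<^sup>2 = (cmod v1)\<^sup>2" "x2\<^sup>2 + y2\<^sup>2 = (cmod v2)\<^sup>2"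
    unfolding xy by (simp_all only: cmod_power2[symmetric] norm_mult complex_mod_cnj u1 mult_1_right)
  have "(v1 * cnj u) * cnj (v2 * cnj u) = (v1 * cnj v2) * (u * cnj u)" by simp
  then have rot: "(v1 * cnj u) * cnj (v2 * cnj u) = v1 * cnj v2" unfolding uu by (simp only: mult_1_right)
  have "Re z * Re z' + Im z * Im z' = Re (z * cnj z')" for z z' :: complex by simp
  then have p: "x1 * x2 + y1 * y2 = Re (v1 * cnj v2)" by (simp only: xy rot)
  have "\<bar>y1\<bar> + \<bar>y2\<bar> > 1/2"
  proof (rule ccontr)
    assume "\<not> \<bar>y1\<bar> + \<bar>y2\<bar> > 1/2"
    then have small: "\<bar>y1\<bar> + \<bar>y2\<bar> \<le> 1/2" by simp
    have "(\<bar>y1\<bar> + \<bar>y2\<bar>)\<^sup>2 \<le> (1/2)\<^sup>2" by (rule power_mono[OF small]) simp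
    moreover have "(\<bar>y1\<bar> + \<bar>y2\<bar>)\<^sup>2 = y1\<^sup>2 + y2\<^sup>2 + 2 * \<bar>y1 * y2\<bar>" by (simp add: power2_sum abs_mult)
    ultimately have sq: "y1\<^sup>2 + y2\<^sup>2 + 2 * \<bar>y1 * y2\<bar> \<le> 1/4" by (simp add: power_divide)
    define s1 s2 \<rho> where "s1 = (cmod v1)\<^sup>2" "s2 = (cmod v2)\<^sup>2" "\<rho> = Re (v1 * cnj v2)"
    note s = this
    have b: "9/20 \<le> s1" "9/20 \<le> s2" "s1 \<le> 11/20" "s2 \<le> 11/20" "\<bar>\<rho>\<bar> \<le> 1/20"
      using v unfolding s by linarith+
    \<comment> \<open>Eliminating the real parts turns near-orthogonality into an identity between
      the lengths and the imaginary parts.\<close>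
    have "(s1 - y1\<^sup>2) * (s2 - y2\<^sup>2) = (x1 * x2)\<^sup>2" using n unfolding s by (simp add: power_mult_distrib flip: n)
    also have "x1 * x2 = \<rho> - y1 * y2" using p unfolding s by simp
    finally have id: "s1 * s2 = s1 * y2\<^sup>2 + s2 * y1\<^sup>2 + \<rho>\<^sup>2 - 2 * (\<rho> * (y1 * y2))"
      by (simp add: power2_eq_square algebra_simps)
    have "9/20 * (9/20) \<le> s1 * s2" by (intro mult_mono) (use b in auto)
    moreover have "s1 * y2\<^sup>2 \<le> 11/20 * y2\<^sup>2" "s2 * y1\<^sup>2 \<le> 11/20 * y1\<^sup>2" by (intro mult_right_mono; use b in simp)+
    moreover have "\<rho>\<^sup>2 \<le> (1/20)\<^sup>2" using b(5) by (metis abs_ge_zero power2_abs power_mono)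
    moreover have "\<bar>\<rho> * (y1 * y2)\<bar> \<le> 1/20 * (1/4)"
    proof -
      have "\<bar>y1 * y2\<bar> \<le> 1/4" using sq zero_le_power2[of y1] zero_le_power2[of y2] by linarith
      then show ?thesis unfolding abs_mult[of \<rho>] using b(5) by (intro mult_mono) auto
    qed
    ultimately show False using sq id by (simp add: power2_eq_square)
  qed
  then have "cmod c * (1/2) < cmod c * (\<bar>y1\<bar> + \<bar>y2\<bar>)" using c by (intro mult_strict_left_mono) auto
  also have "\<dots> \<le> cmod (of_real d1 * v1 - c * cnj v1) + cmod (of_real d2 * v2 - c * cnj v2)"
    using large[OF d(1), of v1] large[OF d(2), of v2] by (simp add: xy distrib_left)
  finally show ?thesis by simp
qed

text \<open>
  Two nonpositive values reduce to two nonnegative ones by changing the signs of \<open>d1\<close>, \<open>d2\<close> and \<open>c\<close>, which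
  keeps the moduli of the remainders.
\<close>
lemma opposite_signs:
  fixes c v1 v2 :: complex and d1 d2 :: real
  assumes c: "c \<noteq> 0" and le: "d1 \<le> d2"
    and v: "\<bar>(cmod v1)\<^sup>2 - 1/2\<bar> \<le> 1/20" "\<bar>(cmod v2)\<^sup>2 - 1/2\<bar> \<le> 1/20" "\<bar>Re (v1 * cnj v2)\<bar> \<le> 1/20"
    and small: "2 * (cmod (of_real d1 * v1 - c * cnj v1) + cmod (of_real d2 * v2 - c * cnj v2)) \<le> cmod c"
  shows "d1 < 0" "d2 > 0"
proof -
  show "d1 < 0"
  proof (rule ccontr)
    assume "\<not> d1 < 0"
    then show False using same_sign_remainder_large[OF c _ _ v, of d1 d2] le small by simp
  qed
  show "d2 > 0"
  proof (rule ccontr)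
    assume "\<not> d2 > 0"
    then have "cmod (- c) / 2 < cmod (of_real (- d1) * v1 - (- c) * cnj v1) + cmod (of_real (- d2) * v2 - (- c) * cnj v2)"
      using c le by (intro same_sign_remainder_large[OF _ _ _ v]) auto
    moreover have "cmod (of_real (- e) * v - (- c) * cnj v) = cmod (of_real e * v - c * cnj v)" for e v
      using norm_minus_cancel[of "of_real e * v - c * cnj v"] by (simp add: algebra_simps)
    ultimately show False using small by simp
  qed
qed

text \<open>
  The integral of a function that is not integrable is \<open>0\<close> by convention, which settles that case.
\<close>
lemma integral_of_real_eq_0:
  assumes "integral S (\<lambda>x. complex_of_real (f x)) = 0"
  shows "integral S f = (0 :: real)"
proof (cases "f integrable_on S")
  case True
  then have "((\<lambda>x. complex_of_real (f x)) has_integral of_real (integral S f)) S"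
    by (intro has_integral_of_real integrable_integral)
  then have "complex_of_real (integral S f) = 0" using assms by (simp add: integral_unique)
  then show ?thesis by simp
qed (rule not_integrable_integral)

lemma smallo_inverse_natI:
  fixes f :: "nat \<Rightarrow> real"
  assumes "(\<lambda>n. pi * real (2 * n + 1) * \<bar>f n\<bar>) \<longlonglongrightarrow> 0"
  shows "f \<in> o(\<lambda>n. 1 / real n)"
proof (rule smalloI_tendsto)
  show "(\<lambda>n. f n / (1 / real n)) \<longlonglongrightarrow> 0"
  proof (rule Lim_null_comparison[OF always_eventually assms], intro allI)
    fix n
    have "real n \<le> pi * real (2 * n + 1)"
      using mult_mono[of 1 pi "real n" "real (2 * n + 1)"] pi_ge_two by simp
    from mult_right_mono[OF this, of "\<bar>f n\<bar>"]
    show "norm (f n / (1 / real n)) \<le> pi * real (2 * n + 1) * \<bar>f n\<bar>" by (simp add: abs_mult mult.commute)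
  qed
  show "\<forall>\<^sub>F n in sequentially. 1 / real n \<noteq> 0"
    using eventually_gt_at_top[of 0] by eventually_elim simp
qed

lemma free_levels_gap:
  assumes "m < n"
  shows "(2 * pi * real m + pi)\<^sup>2 + 8 \<le> (2 * pi * real n + pi)\<^sup>2"
proof -
  have "real m + 1 \<le> real n" using assms by linarith
  then have "2 * pi * (real m + 1) \<le> 2 * pi * real n" by (intro mult_left_mono) auto
  then have "(2 * pi * real m + pi) + 2 * pi \<le> 2 * pi * real n + pi" by (simp add: algebra_simps)
  moreover define A where "A = 2 * pi * real m + pi"
  moreover have "A \<ge> 2" "2 * pi \<ge> 2" unfolding A_def using pi_ge_two by (auto intro: add_increasing)
  ultimately have "(A + 2)\<^sup>2 \<le> (2 * pi * real n + pi)\<^sup>2" by (intro power_mono) auto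
  moreover have "A\<^sup>2 + 8 \<le> (A + 2)\<^sup>2" using \<open>A \<ge> 2\<close> by (simp add: power2_eq_square algebra_simps)
  ultimately show ?thesis unfolding A_def by linarith
qed

text \<open>
  Coincidence with a level of small index is excluded because the levels are unbounded, and coincidence
  with another level of large index because both are within \<open>1\<close> of free levels that lie at least \<open>8\<close>
  apart.
\<close>
lemma levels_separated:
  fixes \<mu> :: "nat \<Rightarrow> nat \<Rightarrow> real"
  assumes lim: "\<And>j. j \<in> {1,2} \<Longrightarrow> (\<lambda>n. \<mu> n j - (2 * pi * real n + pi)\<^sup>2) \<longlonglongrightarrow> 0"
  shows "\<forall>\<^sub>F n in sequentially. \<forall>m. \<forall>i\<in>{1,2}. \<forall>j\<in>{1,2}. \<mu> m i = \<mu> n j \<longrightarrow> m = n"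
proof -
  define l where "l = (\<lambda>n. (2 * pi * real n + pi)\<^sup>2)"
  have ev1: "\<forall>\<^sub>F n in sequentially. \<bar>\<mu> n j - l n\<bar> < 1" if "j \<in> {1,2}" for j
    using tendstoD[OF lim[OF that], of 1] by (simp add: l_def dist_real_def)
  have "\<forall>\<^sub>F n in sequentially. \<forall>j\<in>{1,2}. \<bar>\<mu> n j - l n\<bar> < 1"
    using ev1[of 1] ev1[of 2] by (simp add: eventually_conj_iff)
  then obtain n1 where n1: "\<And>n j. n \<ge> n1 \<Longrightarrow> j \<in> {1,2} \<Longrightarrow> \<bar>\<mu> n j - l n\<bar> < 1"
    unfolding eventually_sequentially by blast
  define B where "B = Max (insert 0 ((\<lambda>(m, i). \<mu> m i) ` ({..<n1} \<times> {1,2})))"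
  have B: "\<mu> m i \<le> B" if "m < n1" "i \<in> {1,2}" for m i
    unfolding B_def by (rule Max_ge) (use that in auto)
  have "filterlim l at_top sequentially" unfolding l_def by real_asymp
  then have "\<forall>\<^sub>F n in sequentially. l n > B + 1" by (simp add: filterlim_at_top_dense)
  then show ?thesis
    using eventually_ge_at_top[of n1]
  proof eventually_elim
    case (elim n)
    show ?case
    proof (intro allI ballI impI)
      fix m i j assume ij: "i \<in> {1,2::nat}" "j \<in> {1,2::nat}" and eq: "\<mu> m i = \<mu> n j"
      have close: "\<bar>\<mu> n j - l n\<bar> < 1" by (rule n1[OF elim(2) ij(2)])
      have m: "m \<ge> n1"
      proof (rule ccontr)
        assume "\<not> m \<ge> n1"
        then have "\<mu> m i \<le> B" by (intro B ij) simp
        then show False using eq close elim(1) by linarith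
      qed
      have "\<bar>\<mu> m i - l m\<bar> < 1" by (rule n1[OF m ij(1)])
      with close eq have "\<bar>l m - l n\<bar> < 8" by linarith
      then show "m = n"
        using free_levels_gap[of m n] free_levels_gap[of n m] unfolding l_def
        by (cases m n rule: linorder_cases) auto
    qed
  qed
qed

theorem theorem3:
  fixes q :: "real \<Rightarrow> real"
    and N0 :: nat
    and \<mu> :: "nat \<Rightarrow> nat \<Rightarrow> real"
    and \<Phi> :: "nat \<Rightarrow> nat \<Rightarrow> real \<Rightarrow> real"
  assumes periodic: "\<And>x. q (x + 1) = q x"
    and L1: "q absolutely_integrable_on {0..1}"
    and mean_zero: "integral {0..1} q = 0"
    and eigenvalues: "large_eigenvalues q N0 \<mu>"
    and eigenfunctions: "normalized_eigenfunctions q N0 \<mu> \<Phi>"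
  shows
    "(\<forall>j\<in>{1,2}. \<exists>a :: nat \<Rightarrow> real. (\<forall>n. a n \<in> {1, -1})
        \<and> (\<lambda>n. \<mu> n j - (2 * pi * real n + pi)\<^sup>2 - a n * cmod (fourier_coeff q (2 * int n + 1)))
            \<in> o(\<lambda>n. 1 / real n))
   \<and> ((\<forall>\<^sub>F n in sequentially.
          2 * (cmod (alpha_tilde q \<mu> \<Phi> n 1) + cmod (alpha_tilde q \<mu> \<Phi> n 2))
            \<le> cmod (fourier_coeff q (2 * int n + 1)))
      \<longrightarrow> (\<exists>N\<ge>N0. \<forall>n\<ge>N. fourier_coeff q (2 * int n + 1) \<noteq> 0
              \<longrightarrow> (\<forall>j\<in>{1,2}. simple_eigenvalue q (complex_of_real (\<mu> n j))))
        \<and> (\<forall>j\<in>{1,2}.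
             (\<lambda>n. \<mu> n j - ((2 * pi * real n + pi)\<^sup>2 + (-1) ^ j * cmod (fourier_coeff q (2 * int n + 1))))
               \<in> o(\<lambda>n. 1 / real n)))"
proof -
  define w where "w = (\<lambda>n::nat. pi * real (2 * n + 1))"
  define qc where "qc = (\<lambda>x. complex_of_real (q x))"
  define d where "d = (\<lambda>j n. \<mu> n j - (2 * pi * real n + pi)\<^sup>2)"
  define c where "c = (\<lambda>n::nat. fourier_coeff q (2 * int n + 1))"
  define \<alpha> where "\<alpha> = (\<lambda>j n. alpha_tilde q \<mu> \<Phi> n j)"
  define v where "v = (\<lambda>j n. v_coeff \<Phi> n j)"
  have w_alt: "w n = 2 * pi * real n + pi" for n by (simp add: w_def algebra_simps)
  have wn: "w n > 0" for n by (simp add: w_def)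
  have qc: "qc absolutely_integrable_on {0..1}" "integral {0..1} qc = 0"
  proof -
    show "qc absolutely_integrable_on {0..1}"
      using absolutely_integrable_linear[OF L1 bounded_linear_of_real] by (simp add: o_def qc_def)
    show "integral {0..1} qc = 0"
      using integral_linear[OF _ bounded_linear_of_real, of q "{0..1}"] L1 mean_zero
        set_lebesgue_integral_eq_integral(1)[OF L1] by (simp add: o_def qc_def)
  qed
  have cnj_exp: "cnj (exp (\<i> * complex_of_real t)) = cis (- t)" for t
    by (simp add: cis_cnj flip: cis_conv_exp)
  have v_eq: "v j n = wave_coeff (\<Phi> n j) (w n)" for j n
    unfolding v_def v_coeff_def L2_inner_def wave_coeff_def cnj_exp w_def by (simp add: add.commute)
  have c_eq: "c n = resonant_coeff qc (w n)" for n
    unfolding c_def fourier_coeff_def L2_inner_def resonant_coeff_def cnj_exp w_def qc_def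
    by (simp add: add.commute mult.assoc)
  have \<alpha>_eq: "\<alpha> j n = of_real (d j n) * v j n - c n * cnj (v j n)" for j n
    by (simp add: \<alpha>_def alpha_tilde_def d_def v_def c_def)
  have ef: "eigenfunction q (of_real (\<mu> n j)) (\<lambda>x. of_real (\<Phi> n j x))"
    and nrm: "L2_norm (\<lambda>x. of_real (\<Phi> n j x)) = 1" if "n \<ge> N0" "j \<in> {1,2}" for n j
    using eigenfunctions that unfolding normalized_eigenfunctions_def by blast+
  have "\<exists>a. mean_zero_standing_wave qc (\<Phi> n j) a (w n) (d j n) (2 * n + 1)"
    if "n \<ge> N0" "j \<in> {1,2}" for n j
  proof -
    have "cis (w n) = - 1" 
      using cis_mult[of "2 * pi * real n" pi] cis_multiple_2pi[of "real n"] by (simp add: w_alt)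
    from eigenfunction_amplitude[OF ef[OF that] wn this] obtain a where
      "abs_cont_deriv a (\<lambda>x. of_real (q x - (\<mu> n j - (w n)\<^sup>2)) * (of_real (\<Phi> n j x) * cis (- w n * x)) / (2 * \<i> * of_real (w n)))"
      "\<And>x. x \<in> {0..1} \<Longrightarrow> of_real (\<Phi> n j x) = a x * cis (w n * x) + cnj (a x) * cis (- w n * x)"
      "a 1 = a 0" by blast
    then have "mean_zero_standing_wave qc (\<Phi> n j) a (w n) (d j n) (2 * n + 1)"
      by unfold_locales (use qc in \<open>simp_all add: w_alt d_def qc_def algebra_simps\<close>)
    then show ?thesis by (intro exI[of _ a])
  qed
  note amplitude_exists = this
  define a where "a = (\<lambda>j n. SOME a. mean_zero_standing_wave qc (\<Phi> n j) a (w n) (d j n) (2 * n + 1))"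
  have a: "mean_zero_standing_wave qc (\<Phi> n j) (a j n) (w n) (d j n) (2 * n + 1)"
    if "n \<ge> N0" "j \<in> {1,2}" for n j
    unfolding a_def by (rule someI_ex[OF amplitude_exists[OF that]])
  have norm1: "integral {0..1} (\<lambda>x. (\<Phi> n j x)\<^sup>2) = 1" if "n \<ge> N0" "j \<in> {1,2}" for n j
    using nrm[OF that] by (simp add: L2_norm_def)
  have dO: "d j \<in> O(\<lambda>n. sqrt (real n))" if "j \<in> {1,2}" for j
    using eigenvalues that unfolding large_eigenvalues_def d_def by blast
  have asym:
    "(\<lambda>n. wave_defect qc (w n) (d j n)) \<longlonglongrightarrow> 0"
    "\<forall>\<^sub>F n in sequentially. cmod (a j n 0) \<le> 2"
    "(\<lambda>n. (cmod (v j n))\<^sup>2) \<longlonglongrightarrow> 1/2"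
    "d j \<longlonglongrightarrow> 0"
    "(\<lambda>n. w n * cmod (\<alpha> j n)) \<longlonglongrightarrow> 0" if j: "j \<in> {1,2}" for j
  proof -
    have e: "\<forall>\<^sub>F n in sequentially. mean_zero_standing_wave qc (\<Phi> n j) (a j n) (pi * real (2 * n + 1)) (d j n) (2 * n + 1)"
      "\<forall>\<^sub>F n in sequentially. integral {0..1} (\<lambda>x. (\<Phi> n j x)\<^sup>2) = 1"
      using a[OF _ j, unfolded w_def] norm1[OF _ j] unfolding eventually_sequentially by blast+
    show "(\<lambda>n. wave_defect qc (w n) (d j n)) \<longlonglongrightarrow> 0"
    "\<forall>\<^sub>F n in sequentially. cmod (a j n 0) \<le> 2"
    "(\<lambda>n. (cmod (v j n))\<^sup>2) \<longlonglongrightarrow> 1/2"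
    "d j \<longlonglongrightarrow> 0"
    "(\<lambda>n. w n * cmod (\<alpha> j n)) \<longlonglongrightarrow> 0"
      using standing_wave_asymptotics[OF e dO[OF j]] unfolding \<alpha>_eq v_eq c_eq w_def by blast+
  qed
  \<comment> \<open>The exact relation between shift and coefficient holds in modulus up to the remainder, and \<open>v\<close> stays away from zero.\<close>
  have gap: "(\<lambda>n. w n * \<bar>\<bar>d j n\<bar> - cmod (c n)\<bar>) \<longlonglongrightarrow> 0" if j: "j \<in> {1,2}" for j
  proof -
    have "\<forall>\<^sub>F n in sequentially. (cmod (v j n))\<^sup>2 > 1/4" using order_tendstoD(1)[OF asym(3)[OF j], of "1/4"] by simp
    then have "\<forall>\<^sub>F n in sequentially. norm (w n * \<bar>\<bar>d j n\<bar> - cmod (c n)\<bar>) \<le> 2 * (w n * cmod (\<alpha> j n))"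
    proof eventually_elim
      case (elim n)
      have "(1/2)\<^sup>2 \<le> (cmod (v j n))\<^sup>2" using elim by (simp add: power2_eq_square)
      then have "1/2 \<le> cmod (v j n)" by (rule power2_le_imp_le) simp
      then have "\<bar>\<bar>d j n\<bar> - cmod (c n)\<bar> * (1/2) \<le> \<bar>\<bar>d j n\<bar> - cmod (c n)\<bar> * cmod (v j n)"
        by (intro mult_left_mono) auto
      also have "\<dots> = \<bar>cmod (of_real (d j n) * v j n) - cmod (c n * cnj (v j n))\<bar>"
        by (simp add: norm_mult left_diff_distrib[symmetric] abs_mult)
      also have "\<dots> \<le> cmod (\<alpha> j n)" unfolding \<alpha>_eq by (rule norm_triangle_ineq3)
      finally have "w n * \<bar>\<bar>d j n\<bar> - cmod (c n)\<bar> \<le> w n * (2 * cmod (\<alpha> j n))"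
        using wn[of n] by (intro mult_left_mono) auto
      then show ?case using wn[of n] by (simp add: abs_mult)
    qed
    then show ?thesis
      by (rule Lim_null_comparison) (rule tendsto_mult_right_zero[OF asym(5)[OF j]])
  qed
  have part_a: "\<exists>s :: nat \<Rightarrow> real. (\<forall>n. s n \<in> {1, -1}) \<and> (\<lambda>n. d j n - s n * cmod (c n)) \<in> o(\<lambda>n. 1 / real n)"
    if j: "j \<in> {1,2}" for j
  proof (intro exI[of _ "\<lambda>n. if d j n \<ge> 0 then 1 else -1"] conjI allI)
    have "\<bar>d j n - (if d j n \<ge> 0 then 1 else -1) * cmod (c n)\<bar> = \<bar>\<bar>d j n\<bar> - cmod (c n)\<bar>" for n by auto
    then show "(\<lambda>n. d j n - (if d j n \<ge> 0 then 1 else -1) * cmod (c n)) \<in> o(\<lambda>n. 1 / real n)"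
      using gap[OF j] by (intro smallo_inverse_natI) (simp only: w_def)
  qed auto
  have one: "1 \<in> {1, 2::nat}" and two: "2 \<in> {1, 2::nat}" by auto
  have part_b: "(\<exists>N\<ge>N0. \<forall>n\<ge>N. c n \<noteq> 0 \<longrightarrow> (\<forall>j\<in>{1,2}. simple_eigenvalue q (complex_of_real (\<mu> n j))))
        \<and> (\<forall>j\<in>{1,2}. (\<lambda>n. d j n - (-1) ^ j * cmod (c n)) \<in> o(\<lambda>n. 1 / real n))"
    if dom: "\<forall>\<^sub>F n in sequentially. 2 * (cmod (\<alpha> 1 n) + cmod (\<alpha> 2 n)) \<le> cmod (c n)"
  proof -
    have ev_v: "\<forall>\<^sub>F n in sequentially. \<bar>(cmod (v j n))\<^sup>2 - 1/2\<bar> \<le> 1/20" if "j \<in> {1,2}" for j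
      using tendstoD[OF asym(3)[OF that], of "1/20"] by (auto simp: dist_real_def elim!: eventually_mono)
    have ev_eps: "\<forall>\<^sub>F n in sequentially. wave_defect qc (w n) (d j n) < 1/3200" if "j \<in> {1,2}" for j
      using order_tendstoD(2)[OF asym(1)[OF that], of "1/3200"] by simp
    have ev_orth: "\<forall>\<^sub>F n in sequentially. \<bar>Re (v 1 n * cnj (v 2 n))\<bar> \<le> 1/20"
      using ev_eps[OF one] ev_eps[OF two] asym(2)[OF one] asym(2)[OF two] eventually_ge_at_top[of N0] 
    proof eventually_elim
      case (elim n)
      interpret W1: mean_zero_standing_wave qc "\<Phi> n 1" "a 1 n" "w n" "d 1 n" "2 * n + 1"
        using elim by (intro a) auto
      interpret W2: mean_zero_standing_wave qc "\<Phi> n 2" "a 2 n" "w n" "d 2 n" "2 * n + 1"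
        using elim by (intro a) auto
      have "L2_inner (\<lambda>x. of_real (\<Phi> n 1 x)) (\<lambda>x. of_real (\<Phi> n 2 x)) = 0"
      proof (cases "\<mu> n 1 = \<mu> n 2")
        case True
        then show ?thesis using eigenfunctions elim unfolding normalized_eigenfunctions_def by blast
      next
        case False
        then show ?thesis using elim by (intro eigenfunctions_orthogonal[OF L1 ef ef]) auto
      qed
      then have "integral {0..1} (\<lambda>x. complex_of_real (\<Phi> n 1 x * \<Phi> n 2 x)) = 0"
        by (simp add: L2_inner_def)
      then have "integral {0..1} (\<lambda>x. \<Phi> n 1 x * \<Phi> n 2 x) = 0"
        by (rule integral_of_real_eq_0)
      then have "\<bar>2 * Re (v 1 n * cnj (v 2 n))\<bar> \<le> 40 * W2.eps * (cmod (a 1 n 0) * cmod (a 2 n 0))"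
        using standing_wave_inner_product[OF W1.standing_wave_axioms W2.standing_wave_axioms] elim
        by (simp add: v_eq)
      \<comment> \<open>The amplitudes are at most \<open>2\<close>, and \<open>40 (1/3200) 4 = 1/20\<close> is within the
        tolerance of \<open>opposite_signs\<close>.\<close>
      also have "\<dots> \<le> 40 * (1/3200) * (2 * 2)"
        using elim W2.eps_nonneg by (intro mult_mono) auto
      finally show ?case using abs_mult[of 2 "Re (v 1 n * cnj (v 2 n))"] by linarith
    qed
    have "\<forall>\<^sub>F n in sequentially. c n \<noteq> 0 \<longrightarrow> d 1 n < 0 \<and> d 2 n > 0"
      using ev_v[OF one] ev_v[OF two] ev_orth dom eventually_ge_at_top[of N0]
    proof eventually_elim
      case (elim n)
      have "d 1 n \<le> d 2 n" using eigenvalues elim by (simp add: large_eigenvalues_def d_def)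
      then show ?case
        using opposite_signs[of "c n" "d 1 n" "d 2 n" "v 1 n" "v 2 n"] elim unfolding \<alpha>_eq by blast
    qed
    note signs = this
    have lim: "(\<lambda>n. \<mu> n j - (2 * pi * real n + pi)\<^sup>2) \<longlonglongrightarrow> 0" if "j \<in> {1,2}" for j
      using asym(4)[OF that] by (simp add: d_def)
    have sep: "\<forall>\<^sub>F n in sequentially. \<forall>m. \<forall>i\<in>{1,2}. \<forall>j\<in>{1,2}. \<mu> m i = \<mu> n j \<longrightarrow> m = n"
      by (rule levels_separated) (rule lim)
    obtain R where R: "\<And>n j. n \<ge> N0 \<Longrightarrow> j \<in> {1,2} \<Longrightarrow> R \<le> \<mu> n j"
      "\<And>t. t \<ge> R \<Longrightarrow> card {(n, j). N0 \<le> n \<and> j \<in> {1,2} \<and> \<mu> n j = t} = eigenvalue_multiplicity q (complex_of_real t)"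
      using eigenvalues unfolding large_eigenvalues_def by blast
    have "\<forall>\<^sub>F n in sequentially. n \<ge> N0 \<and> (c n \<noteq> 0 \<longrightarrow> (\<forall>j\<in>{1,2}. simple_eigenvalue q (complex_of_real (\<mu> n j))))"
      using signs sep eventually_ge_at_top[of N0]
    proof eventually_elim
      case (elim n)
      have "simple_eigenvalue q (complex_of_real (\<mu> n j))" if "c n \<noteq> 0" and j: "j \<in> {1,2}" for j
      proof -
        have ne: "\<mu> n 1 \<noteq> \<mu> n 2" using elim(1) that by (auto simp: d_def)
        have "{(m, i). N0 \<le> m \<and> i \<in> {1,2} \<and> \<mu> m i = \<mu> n j} = {(n, j)}" (is "?A = _")
        proof (rule set_eqI)
          fix p :: "nat \<times> nat"
          obtain m i where p: "p = (m, i)" by (cases p)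
          have "(N0 \<le> m \<and> i \<in> {1,2} \<and> \<mu> m i = \<mu> n j) \<longleftrightarrow> m = n \<and> i = j"
          proof
            assume mi: "N0 \<le> m \<and> i \<in> {1,2} \<and> \<mu> m i = \<mu> n j"
            then have "m = n" using elim(2) j by blast
            then show "m = n \<and> i = j" using mi j ne ne[symmetric] by fastforce
          next
            assume "m = n \<and> i = j"
            then show "N0 \<le> m \<and> i \<in> {1,2} \<and> \<mu> m i = \<mu> n j" using elim(3) j by simp
          qed
          then show "p \<in> ?A \<longleftrightarrow> p \<in> {(n, j)}" by (simp only: p mem_Collect_eq case_prod_conv singleton_iff prod.inject)
        qed
        then have "eigenvalue_multiplicity q (complex_of_real (\<mu> n j)) = card {(n, j)}"
          using R(2)[OF R(1)[OF elim(3) j]] by (simp only:)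
        then show ?thesis unfolding simple_eigenvalue_def by simp
      qed
      then show ?case using elim(3) by blast
    qed
    then obtain N where "\<forall>n\<ge>N. n \<ge> N0 \<and> (c n \<noteq> 0 \<longrightarrow> (\<forall>j\<in>{1,2}. simple_eigenvalue q (complex_of_real (\<mu> n j))))"
      unfolding eventually_sequentially by blast
    then have simple: "\<exists>N\<ge>N0. \<forall>n\<ge>N. c n \<noteq> 0 \<longrightarrow> (\<forall>j\<in>{1,2}. simple_eigenvalue q (complex_of_real (\<mu> n j)))"
      by blast
    have "(\<lambda>n. d j n - (-1) ^ j * cmod (c n)) \<in> o(\<lambda>n. 1 / real n)" if j: "j \<in> {1,2}" for j
    proof (rule smallo_inverse_natI[OF Lim_transform_eventually[OF gap[OF j]]])
      show "\<forall>\<^sub>F n in sequentially. w n * \<bar>\<bar>d j n\<bar> - cmod (c n)\<bar>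
          = pi * real (2 * n + 1) * \<bar>d j n - (-1) ^ j * cmod (c n)\<bar>"
        using signs
      proof eventually_elim
        case (elim n)
        have "\<bar>\<bar>d j n\<bar> - cmod (c n)\<bar> = \<bar>d j n - (-1) ^ j * cmod (c n)\<bar>"
        proof (cases "c n = 0")
          case False
          then show ?thesis using elim j by auto
        qed simp
        then show ?case by (simp only: w_def)
      qed
    qed
    with simple show ?thesis by blast
  qed
  show ?thesis
    using part_a part_b unfolding d_def c_def \<alpha>_def diff_diff_eq[symmetric] by blast
qed

end
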